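(* There is a catalytic algorithm that, given oracle access to a directed graph $G$ with $n$ vertices and $m\ge n$ edges, together with vertices $s,t$ and parameters $T\in\mathbb{N}$, $\varepsilon>0$, returns a number $\rho$ such that \[\bigl|\rho-\Pr[\text{a $T$-step random walk from $s$ ends at $t$}]\bigr|\le\varepsilon.\] The algorithm runs in time $\widetilde{O}(mT^2/\varepsilon)$ and uses $O(\log(mT/\varepsilon))$ workspace and $\widetilde{O}(nT\cdot\log(m/\varepsilon))$ catalytic space.
   Context: A random walk on a directed graph moves at each step from the current vertex to a uniformly random out-neighbor (following a uniformly random outgoing edge). Catalytic (RAM) model: read-only input, small read-write work tape, a read-write catalytic tape starting in an arbitrary configuration $\tau$ that must be restored exactly to $\tau$ at halting (for every input and every $\tau$), constant-time random access to catalytic tape bits, and write-only output. Oracle access to a graph: vertex set $[n]$, with queries for in-degree, out-degree, $i$-th in-neighbor and $i$-th out-neighbor of any vertex. $\widetilde{O}(\cdot)$ hides polylogarithmic factors. *)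

theory Defs
  imports
    "HOL-Probability.Probability_Mass_Function"
    "HOL-Library.Log_Nat"
    "Graph_Theory.Digraph"
begin

text \<open>
  \<^typ>\<open>('a, 'b) pre_digraph\<close> has arcs of their own, so parallel arcs and loops are allowed and a
  step follows a uniformly random outgoing arc.  At a vertex without outgoing arcs, where no such
  step exists, the walk stays put.
\<close>

definition walk_step :: "('a, 'b) pre_digraph \<Rightarrow> 'a \<Rightarrow> 'a pmf" where
  "walk_step G v =
     (if out_arcs G v = {} then return_pmf v else map_pmf (head G) (pmf_of_set (out_arcs G v)))"

primrec walk_end :: "('a, 'b) pre_digraph \<Rightarrow> 'a \<Rightarrow> nat \<Rightarrow> 'a pmf" where
  "walk_end G s 0 = return_pmf s"
| "walk_end G s (Suc T) = bind_pmf (walk_end G s T) (walk_step G)"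

text \<open>
  \<open>out_list I v\<close> and \<open>in_list I v\<close> fix the (arbitrary) orders that give a meaning to
  ``the \<open>i\<close>-th out-neighbour'' and ``the \<open>i\<close>-th in-neighbour''.  A program sees them, and the graph,
  only through the four queries below.
\<close>

record walk_input =
  graph :: "(nat, nat) pre_digraph"
  out_list :: "nat \<Rightarrow> nat list"
  in_list :: "nat \<Rightarrow> nat list"
  source :: nat
  target :: nat
  steps :: nat
  eps :: real

definition valid_input :: "walk_input \<Rightarrow> bool" where
  "valid_input I \<longleftrightarrow>
     fin_digraph (graph I) \<and>
     verts (graph I) = {1..card (verts (graph I))} \<and>
     (\<forall>v \<in> verts (graph I). distinct (out_list I v) \<and> set (out_list I v) = out_arcs (graph I) v) \<and>
     (\<forall>v \<in> verts (graph I). distinct (in_list I v) \<and> set (in_list I v) = in_arcs (graph I) v) \<and>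
     source I \<in> verts (graph I) \<and>
     target I \<in> verts (graph I) \<and>
     eps I > 0"

text \<open>Neighbours are numbered from 1; the non-vertex 0 answers a meaningless query.\<close>

definition out_neighbor :: "walk_input \<Rightarrow> nat \<Rightarrow> nat \<Rightarrow> nat" where
  "out_neighbor I v i =
     (if v \<in> verts (graph I) \<and> 1 \<le> i \<and> i \<le> out_degree (graph I) v
      then head (graph I) (out_list I v ! (i - 1)) else 0)"

definition in_neighbor :: "walk_input \<Rightarrow> nat \<Rightarrow> nat \<Rightarrow> nat" where
  "in_neighbor I v i =
     (if v \<in> verts (graph I) \<and> 1 \<le> i \<and> i \<le> in_degree (graph I) v
      then tail (graph I) (in_list I v ! (i - 1)) else 0)"

text \<open>
  The work memory of a program is a fixed finite set of registers holding natural numbers.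
  \<open>Load\<close> reads the read-only input.  The real parameter \<open>eps\<close> is read by comparing it with
  fractions: \<open>CmpEps x y z\<close> tests whether \<open>y / z \<le> eps\<close>.  The catalytic tape is an array of bits,
  addressed by register contents.  \<open>Emit\<close> appends a number to the write-only output.
  There is no other way to store anything.
\<close>

type_synonym reg = nat

datatype input_item = NumVerts | Source | Target | Steps

datatype arith = Add | Sub | Mul | Div

datatype instr =
    Const reg nat
  | Arith arith reg reg reg
  | Load reg input_item
  | CmpEps reg reg reg
  | OutDegree reg reg
  | InDegree reg reg
  | OutNeighbor reg reg reg
  | InNeighbor reg reg reg
  | ReadCat reg reg
  | WriteCat reg reg
  | Emit reg

datatype prog =
    Instr instr
  | Seq prog prog
  | Branch reg prog prog
  | While reg prog

record state =
  regs :: "reg \<Rightarrow> nat"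
  cat_tape :: "nat \<Rightarrow> bool"
  out_tape :: "nat list"

fun arith_val :: "arith \<Rightarrow> nat \<Rightarrow> nat \<Rightarrow> nat" where
  "arith_val Add a b = a + b"
| "arith_val Sub a b = a - b"
| "arith_val Mul a b = a * b"
| "arith_val Div a b = a div b"

fun input_val :: "walk_input \<Rightarrow> input_item \<Rightarrow> nat" where
  "input_val I NumVerts = card (verts (graph I))"
| "input_val I Source = source I"
| "input_val I Target = target I"
| "input_val I Steps = steps I"

definition set_reg :: "reg \<Rightarrow> nat \<Rightarrow> state \<Rightarrow> state" where
  "set_reg x a \<sigma> = \<sigma>\<lparr>regs := (regs \<sigma>)(x := a)\<rparr>"

fun effect :: "walk_input \<Rightarrow> instr \<Rightarrow> state \<Rightarrow> state" where
  "effect I (Const x a) \<sigma> = set_reg x a \<sigma>"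
| "effect I (Arith f x y z) \<sigma> = set_reg x (arith_val f (regs \<sigma> y) (regs \<sigma> z)) \<sigma>"
| "effect I (Load x i) \<sigma> = set_reg x (input_val I i) \<sigma>"
| "effect I (CmpEps x y z) \<sigma> =
     set_reg x (of_bool (real (regs \<sigma> y) \<le> real (regs \<sigma> z) * eps I)) \<sigma>"
| "effect I (OutDegree x y) \<sigma> = set_reg x (out_degree (graph I) (regs \<sigma> y)) \<sigma>"
| "effect I (InDegree x y) \<sigma> = set_reg x (in_degree (graph I) (regs \<sigma> y)) \<sigma>"
| "effect I (OutNeighbor x y z) \<sigma> = set_reg x (out_neighbor I (regs \<sigma> y) (regs \<sigma> z)) \<sigma>"
| "effect I (InNeighbor x y z) \<sigma> = set_reg x (in_neighbor I (regs \<sigma> y) (regs \<sigma> z)) \<sigma>"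
| "effect I (ReadCat x y) \<sigma> = set_reg x (of_bool (cat_tape \<sigma> (regs \<sigma> y))) \<sigma>"
| "effect I (WriteCat x y) \<sigma> = \<sigma>\<lparr>cat_tape := (cat_tape \<sigma>)(regs \<sigma> x := (regs \<sigma> y \<noteq> 0))\<rparr>"
| "effect I (Emit x) \<sigma> = \<sigma>\<lparr>out_tape := out_tape \<sigma> @ [regs \<sigma> x]\<rparr>"

fun cat_addresses :: "instr \<Rightarrow> state \<Rightarrow> nat set" where
  "cat_addresses (ReadCat x y) \<sigma> = {regs \<sigma> y}"
| "cat_addresses (WriteCat x y) \<sigma> = {regs \<sigma> x}"
| "cat_addresses _ \<sigma> = {}"

text \<open>
  Total number of bits held in registers.  All registers start at 0, so in every reachable state
  only finitely many are nonzero.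
\<close>

definition workspace :: "state \<Rightarrow> nat" where
  "workspace \<sigma> = (\<Sum>x | regs \<sigma> x \<noteq> 0. nat (bitlen (int (regs \<sigma> x))))"

text \<open>
  \<open>exec I S A c \<sigma> n \<sigma>'\<close>: on a machine with \<open>S\<close> bits of workspace and a catalytic tape of \<open>A\<close> bits
  (the cells \<open>0, \<dots>, A - 1\<close>), program \<open>c\<close> started in \<open>\<sigma>\<close> halts in \<open>\<sigma>'\<close> after \<open>n\<close> time steps, each an
  instruction or a test.  Register contents count towards the workspace, so unit-cost arithmetic
  acts on words of at most \<open>S\<close> bits.
\<close>

inductive exec ::
  "walk_input \<Rightarrow> nat \<Rightarrow> nat \<Rightarrow> prog \<Rightarrow> state \<Rightarrow> nat \<Rightarrow> state \<Rightarrow> bool"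
  for I :: walk_input and S A :: nat
where
  Instr: "workspace (effect I i \<sigma>) \<le> S \<Longrightarrow> cat_addresses i \<sigma> \<subseteq> {..<A} \<Longrightarrow>
          exec I S A (Instr i) \<sigma> 1 (effect I i \<sigma>)"
| Seq: "exec I S A c \<sigma> n \<sigma>' \<Longrightarrow> exec I S A d \<sigma>' n' \<sigma>'' \<Longrightarrow> exec I S A (Seq c d) \<sigma> (n + n') \<sigma>''"
| BranchTrue: "regs \<sigma> x \<noteq> 0 \<Longrightarrow> exec I S A c \<sigma> n \<sigma>' \<Longrightarrow> exec I S A (Branch x c d) \<sigma> (Suc n) \<sigma>'"
| BranchFalse: "regs \<sigma> x = 0 \<Longrightarrow> exec I S A d \<sigma> n \<sigma>' \<Longrightarrow> exec I S A (Branch x c d) \<sigma> (Suc n) \<sigma>'"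
| WhileTrue: "regs \<sigma> x \<noteq> 0 \<Longrightarrow> exec I S A c \<sigma> n \<sigma>' \<Longrightarrow> exec I S A (While x c) \<sigma>' n' \<sigma>'' \<Longrightarrow>
              exec I S A (While x c) \<sigma> (Suc (n + n')) \<sigma>''"
| WhileFalse: "regs \<sigma> x = 0 \<Longrightarrow> exec I S A (While x c) \<sigma> 1 \<sigma>"

inductive_cases exec_InstrE: "exec I S A (Instr i) \<sigma> n \<sigma>'"
inductive_cases exec_SeqE: "exec I S A (Seq c d) \<sigma> n \<sigma>'"
inductive_cases exec_BranchE: "exec I S A (Branch x c d) \<sigma> n \<sigma>'"
inductive_cases exec_WhileE: "exec I S A (While x c) \<sigma> n \<sigma>'"

lemma exec_deterministic:
  "exec I S A c \<sigma> n \<sigma>' \<Longrightarrow> exec I S' A' c \<sigma> n' \<sigma>'' \<Longrightarrow> n' = n \<and> \<sigma>'' = \<sigma>'"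
proof (induction arbitrary: n' \<sigma>'' rule: exec.induct)
  case (Instr i \<sigma>)
  then show ?case by (auto elim: exec_InstrE)
next
  case (Seq c \<sigma> n \<sigma>' d m \<sigma>2)
  from Seq.prems show ?case by (rule exec_SeqE) (use Seq.IH in blast)
next
  case (BranchTrue \<sigma> x c n \<sigma>' d)
  from BranchTrue.prems show ?case by (rule exec_BranchE) (use BranchTrue in auto)
next
  case (BranchFalse \<sigma> x d n \<sigma>' c)
  from BranchFalse.prems show ?case by (rule exec_BranchE) (use BranchFalse in auto)
next
  case (WhileTrue \<sigma> x c n \<sigma>' m \<sigma>2)
  from WhileTrue.prems show ?case by (rule exec_WhileE) (use WhileTrue in blast)+
next
  case (WhileFalse \<sigma> x c)
  from WhileFalse.prems show ?case by (rule exec_WhileE) (use WhileFalse in auto)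
qed

definition init_state :: "(nat \<Rightarrow> bool) \<Rightarrow> state" where
  "init_state \<tau> = \<lparr>regs = (\<lambda>_. 0), cat_tape = \<tau>, out_tape = []\<rparr>"

definition catalytic_run ::
  "prog \<Rightarrow> walk_input \<Rightarrow> nat \<Rightarrow> nat \<Rightarrow> (nat \<Rightarrow> bool) \<Rightarrow> nat \<Rightarrow> nat list \<Rightarrow> bool" where
  "catalytic_run P I S A \<tau> time out \<longleftrightarrow>
     (\<exists>\<sigma>. exec I S A P (init_state \<tau>) time \<sigma> \<and> cat_tape \<sigma> = \<tau> \<and> out_tape \<sigma> = out)"

definition catalytic_algorithm :: "prog \<Rightarrow> bool" where
  "catalytic_algorithm P \<longleftrightarrow>
     (\<forall>I. valid_input I \<longrightarrow> (\<exists>S A. \<forall>\<tau>. \<exists>time out. catalytic_run P I S A \<tau> time out))"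

text \<open>A rational number is output as numerator and denominator.\<close>

definition encodes :: "nat list \<Rightarrow> real \<Rightarrow> bool" where
  "encodes out \<rho> \<longleftrightarrow> (\<exists>p q. out = [p, q] \<and> q > 0 \<and> \<rho> = real p / real q)"

text \<open>
  The shifts keep the bounds meaningful for all parameter values, for instance when \<open>eps\<close> is so
  large that \<open>m T / eps < 1\<close>.  For \<open>x \<ge> 2\<close>, \<open>lg x\<close> is within a factor 2 of the binary logarithm.
  \<open>soft_O C k f\<close> bounds \<open>O(f polylog f)\<close> with constant \<open>C\<close> and exponent \<open>k\<close>.
\<close>

definition lg :: "real \<Rightarrow> real" where
  "lg x = log 2 (2 + x)"

definition soft_O :: "nat \<Rightarrow> nat \<Rightarrow> real \<Rightarrow> real" where
  "soft_O C k f = real C * (1 + f) * lg f ^ k"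

end

theory Submission
  imports Defs
begin

text \<open>
  The walks follow rotors.  Every pair of a layer (number of steps left) and a vertex owns a cyclic
  \<open>b\<close>-bit counter on the catalytic tape, with arbitrary initial value.  A walk leaves a vertex
  along the arc given by the counter modulo the out-degree, then increments the counter.  Since no
  counter is used twice in one walk, a walk that decrements each counter before reading it
  retraces the last walk and undoes it; as many such walks as before restore the tape.

  Accuracy: if \<open>h i v\<close> is the probability that \<open>i\<close> steps lead from \<open>v\<close> to the target, a
  step from \<open>v\<close> to \<open>w\<close> changes the hitting probability by \<open>h (i - 1) w - h i v\<close>, and these
  changes sum to 0 over a full turn of the rotor.  So their sum over the past turns of one
  counter is at most the out-degree, or twice that after one wrap-around.  Summing over all
  counters, the number of hits among \<open>K\<close> walks is \<open>K h T s\<close> up to \<open>3 m T\<close>, and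
  \<open>K = 3 m T Z\<close> walks with a power of two \<open>Z \<ge> 1 / \<epsilon>\<close> suffice.
\<close>

section \<open>Rotor walks\<close>

text \<open>An arbitrary initial tape is the obstacle to rotors stored modulo the out-degree: not
  every bit pattern would be a legal rotor position, and none may be lost. Counting modulo
  \<open>2 ^ b\<close> permutes all patterns of a \<open>b\<close>-bit block, so nothing has to be
  known about the contents. The price is that \<open>2 ^ b\<close> need not be a multiple of the
  out-degree, so a rotor jumps when its counter wraps around. Choosing \<open>b\<close> with
  \<open>K \<le> 2 ^ b\<close> allows at most one jump per counter, because one walk advances a
  counter at most once. This explains the factor 3: the initial contents cost at most one out-degree
  per counter, the final contents at most two.

  Undoing does not traverse paths backwards. Each undoing walk starts at the source again and finds
  its way from the decremented counters, so neither the path nor any in-neighbour has to be known,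
  and one program serves both directions.\<close>

definition next_vertex :: "walk_input \<Rightarrow> nat \<Rightarrow> nat \<Rightarrow> nat" where
  "next_vertex I v r =
     (let w = out_neighbor I v (Suc (r mod out_degree (graph I) v)) in if w = 0 then v else w)"

definition hit :: "walk_input \<Rightarrow> nat \<Rightarrow> nat \<Rightarrow> real" where
  "hit I i v = pmf (walk_end (graph I) v i) (target I)"

text \<open>\<open>walk_end\<close> appends steps at the end, whereas a rotor walk is analysed by
  its first step; associativity of bind moves the extra step to the front.\<close>

lemma walk_end_Suc_shift:
  "walk_end G v (Suc i) = bind_pmf (walk_step G v) (\<lambda>w. walk_end G w i)"
proof (induction i)
  case 0
  then show ?case by (simp add: bind_return_pmf bind_return_pmf')
next
  case (Suc i)
  have "walk_end G v (Suc (Suc i)) = bind_pmf (walk_end G v (Suc i)) (walk_step G)" by simp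
  also have "\<dots> = bind_pmf (bind_pmf (walk_step G v) (\<lambda>w. walk_end G w i)) (walk_step G)"
    by (simp only: Suc.IH)
  also have "\<dots> = bind_pmf (walk_step G v) (\<lambda>w. walk_end G w (Suc i))"
    by (simp add: bind_assoc_pmf)
  finally show ?case .
qed

lemma hit_bounds: "0 \<le> hit I i v" "hit I i v \<le> 1"
  by (simp_all add: hit_def pmf_le_1)

lemma sum_lessThan_add:
  fixes g :: "nat \<Rightarrow> real"
  shows "(\<Sum>x<d + e. g x) = (\<Sum>x<d. g x) + (\<Sum>x<e. g (d + x))"
  by (induction e) auto

text \<open>Complete periods cancel, and what remains has at most \<open>d\<close> terms, each of
  absolute value at most 1.\<close>

lemma abs_sum_periodic_le:
  fixes g :: "nat \<Rightarrow> real"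
  assumes d: "d > 0"
    and period: "\<And>x. g (x + d) = g x"
    and zero: "(\<Sum>x<d. g x) = 0"
    and bound: "\<And>x. \<bar>g x\<bar> \<le> 1"
  shows "\<bar>\<Sum>x<c. g x\<bar> \<le> real d"
proof (induction c rule: less_induct)
  case (less c)
  show ?case
  proof (cases "c \<le> d")
    case True
    have "\<bar>\<Sum>x<c. g x\<bar> \<le> (\<Sum>x<c. \<bar>g x\<bar>)" by (rule sum_abs)
    also have "\<dots> \<le> real c" using sum_mono[of "{..<c}" "\<lambda>x. \<bar>g x\<bar>" "\<lambda>_. 1"] bound by simp
    finally show ?thesis using True by linarith
  next
    case False
      from False obtain e where c: "c = d + e" by (metis le_add_diff_inverse nat_le_linear)
      have "(\<Sum>x<c. g x) = (\<Sum>x<e. g x)"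
        using zero period by (simp add: c sum_lessThan_add add.commute)
      then show ?thesis using less[of e] d c by simp
  qed
qed

section \<open>Rotor moves and the one-step recursion of hitting probabilities\<close>

locale rotor_walk =
  fixes I :: walk_input
  assumes valid: "valid_input I"
begin

abbreviation "G \<equiv> graph I"
abbreviation "V \<equiv> verts G"
abbreviation "n \<equiv> card (verts (graph I))"
abbreviation "deg v \<equiv> out_degree (graph I) v"

lemma fin_digraph_G: "fin_digraph G"
  and V_eq: "V = {1..n}"
  and source_in_V: "source I \<in> V"
  and target_in_V: "target I \<in> V"
  and eps_pos: "eps I > 0"
  and out_list: "v \<in> V \<Longrightarrow> distinct (out_list I v)" "v \<in> V \<Longrightarrow> set (out_list I v) = out_arcs G v"
  using valid by (auto simp: valid_input_def)

sublocale fin_digraph G by (rule fin_digraph_G)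

lemma V_iff: "v \<in> V \<longleftrightarrow> 1 \<le> v \<and> v \<le> n"
  by (subst V_eq) simp

lemma length_out_list: "v \<in> V \<Longrightarrow> length (out_list I v) = deg v"
  using out_list by (metis distinct_card out_degree_def)

lemma next_vertex_head:
  assumes "v \<in> V" "deg v > 0"
  shows "next_vertex I v r = head G (out_list I v ! (r mod deg v))"
proof -
  have "r mod deg v < deg v" using assms by simp
  then have "out_list I v ! (r mod deg v) \<in> out_arcs G v"
    using assms out_list(2) length_out_list by (metis nth_mem)
  then have "head G (out_list I v ! (r mod deg v)) \<in> V" by simp
  then show ?thesis using assms \<open>r mod deg v < deg v\<close> V_iff
    by (auto simp: next_vertex_def out_neighbor_def Let_def)
qed

text \<open>Since \<open>r mod 0 = r\<close>, the query asks for neighbour \<open>Suc r\<close> of a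
  vertex without any, the oracle answers 0, and the walk stays put as \<open>walk_step\<close>
  demands.\<close>

lemma next_vertex_sink: "deg v = 0 \<Longrightarrow> next_vertex I v r = v"
  by (simp add: next_vertex_def out_neighbor_def Let_def)

lemma next_vertex_in_V:
  assumes "v \<in> V"
  shows "next_vertex I v r \<in> V"
proof (cases "deg v = 0")
  case False
  then have "out_list I v ! (r mod deg v) \<in> out_arcs G v"
    using assms out_list(2) length_out_list by (metis nth_mem mod_less_divisor neq0_conv)
  then show ?thesis using assms False by (simp add: next_vertex_head)
qed (use assms in \<open>simp add: next_vertex_sink\<close>)

text \<open>Averaging over the outgoing arcs, multiplied by the out-degree: in this form it says
  that the changes of the hitting probability cancel over a full turn of the rotor. At a sink it
  degenerates to \<open>0 = 0\<close>, which is why the second equation is stated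
  separately.\<close>

lemma hit_Suc:
  assumes v: "v \<in> V"
  shows "real (deg v) * hit I (Suc i) v = (\<Sum>k<deg v. hit I i (next_vertex I v k))"
    and "deg v = 0 \<Longrightarrow> hit I (Suc i) v = hit I i v"
proof -
  have E: "hit I (Suc i) v = measure_pmf.expectation (walk_step G v) (hit I i)"
    by (simp only: hit_def[abs_def] walk_end_Suc_shift pmf_bind)
  have fin: "finite (out_arcs G v)" by auto
  show "hit I (Suc i) v = hit I i v" if "deg v = 0"
    using that fin by (simp add: E walk_step_def out_degree_def)
  show "real (deg v) * hit I (Suc i) v = (\<Sum>k<deg v. hit I i (next_vertex I v k))"
  proof (cases "deg v = 0")
    case False
    then have ne: "out_arcs G v \<noteq> {}" by (auto simp: out_degree_def)
    have "measure_pmf.expectation (walk_step G v) (hit I i) =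
        (\<Sum>a\<in>out_arcs G v. hit I i (head G a)) / deg v"
      using ne fin by (simp add: walk_step_def integral_pmf_of_set out_degree_def)
    moreover have "(\<Sum>a\<in>out_arcs G v. hit I i (head G a)) =
        (\<Sum>k<deg v. hit I i (head G (out_list I v ! k)))"
      using bij_betw_nth[OF out_list(1)[OF v] refl refl]
      by (intro sum.reindex_bij_betw[symmetric]) (simp add: out_list(2) length_out_list v)
    moreover have "(\<Sum>k<deg v. hit I i (head G (out_list I v ! k))) =
        (\<Sum>k<deg v. hit I i (next_vertex I v k))"
      using False by (intro sum.cong) (simp_all add: next_vertex_head v)
    ultimately show ?thesis using False by (simp add: E)
  qed simp
qed

lemma sum_out_degree: "(\<Sum>v\<in>V. deg v) = card (arcs G)"
proof -
  have "arcs G = (\<Union>v\<in>V. out_arcs G v)" by auto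
  moreover have "card (\<Union>v\<in>V. out_arcs G v) = (\<Sum>v\<in>V. card (out_arcs G v))"
    by (rule card_UN_disjoint) auto
  ultimately show ?thesis by (simp add: out_degree_def)
qed

text \<open>
  In \<open>uwalk\<close> the counters never wrap around, only the arc choice sees them modulo \<open>M\<close>; this
  makes the potential below telescope.  In \<open>rwalk\<close> the offsets \<open>a = 0\<close>, \<open>e = 1\<close> give the
  walk on the tape and \<open>a = M - 1\<close>, \<open>e = 0\<close> its undoing.
\<close>

primrec uwalk :: "nat \<Rightarrow> nat \<Rightarrow> nat \<Rightarrow> (nat \<Rightarrow> nat) \<Rightarrow> nat \<times> (nat \<Rightarrow> nat)" where
  "uwalk M 0 v F = (v, F)"
| "uwalk M (Suc i) v F =
     (let q = Suc i * n + v in uwalk M i (next_vertex I v (F q mod M)) (F(q := Suc (F q))))"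

primrec rwalk :: "nat \<Rightarrow> nat \<Rightarrow> nat \<Rightarrow> nat \<Rightarrow> nat \<Rightarrow> (nat \<Rightarrow> nat) \<Rightarrow> nat \<times> (nat \<Rightarrow> nat)" where
  "rwalk M a e 0 v F = (v, F)"
| "rwalk M a e (Suc i) v F =
     (let q = Suc i * n + v; r = (F q + a) mod M
      in rwalk M a e i (next_vertex I v r) (F(q := (r + e) mod M)))"

declare uwalk.simps(2) [simp del] rwalk.simps(2) [simp del]

section \<open>Layers: locality and invertibility of rotor walks\<close>

lemma uwalk_Suc:
  "q = Suc i * n + v \<Longrightarrow>
   uwalk M (Suc i) v F = uwalk M i (next_vertex I v (F q mod M)) (F(q := Suc (F q)))"
  by (simp add: uwalk.simps(2) Let_def)

lemma rwalk_Suc: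
  "q = Suc i * n + v \<Longrightarrow>
   rwalk M a e (Suc i) v F =
     rwalk M a e i (next_vertex I v ((F q + a) mod M)) (F(q := ((F q + a) mod M + e) mod M))"
  by (simp add: rwalk.simps(2) Let_def)

text \<open>Reduction modulo \<open>M\<close> commutes with incrementing, and the unbounded walk
  looks at residues only. This carries results on \<open>uwalk\<close> over to the tape.\<close>

lemma rwalk_uwalk:
  "rwalk M 0 1 i v (\<lambda>q. F q mod M) =
     (fst (uwalk M i v F), \<lambda>q. snd (uwalk M i v F) q mod M)"
proof (induction i arbitrary: v F)
  case (Suc i)
  define q where "q = Suc i * n + v"
  have "(\<lambda>q. F q mod M)(q := (F q mod M mod M + 1) mod M) = (\<lambda>x. (F(q := Suc (F q))) x mod M)"
    by (auto simp: mod_simps)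
  then show ?case using Suc[of "next_vertex I v (F q mod M)" "F(q := Suc (F q))"]
    by (simp add: uwalk_Suc[OF q_def] rwalk_Suc[OF q_def] fun_upd_def)
qed simp

text \<open>Vertices are \<open>1, ..., n\<close>, so layer \<open>j\<close> occupies the addresses
  from \<open>j * n + 1\<close> to \<open>j * n + n\<close>, and the layers are disjoint. With
  \<open>i\<close> steps left only layers up to \<open>i\<close> can be touched.\<close>

lemma uwalk_eq_beyond:
  assumes "v \<in> V" "x > i * n + n"
  shows "snd (uwalk M i v F) x = F x"
  using assms
proof (induction i arbitrary: v F)
  case (Suc i)
  have "x \<noteq> Suc i * n + v" using Suc.prems V_iff by auto
  then show ?case using Suc.prems Suc.IH[OF next_vertex_in_V[OF Suc.prems(1)]]
    by (simp add: uwalk_Suc[OF refl])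
qed simp

text \<open>After its use a counter lies above all layers still to come, so one walk advances it at
  most once. Over \<open>K\<close> walks this limits the growth of a counter to
  \<open>K\<close>.\<close>

lemma uwalk_le_Suc:
  assumes "v \<in> V"
  shows "F x \<le> snd (uwalk M i v F) x \<and> snd (uwalk M i v F) x \<le> Suc (F x)"
  using assms
proof (induction i arbitrary: v F)
  case (Suc i)
  define q where "q = Suc i * n + v"
  have v': "next_vertex I v (F q mod M) \<in> V" using Suc.prems by (rule next_vertex_in_V)
  show ?case
  proof (cases "x = q")
    case True
    then have "x > i * n + n" using Suc.prems V_iff q_def by auto
    then show ?thesis using uwalk_eq_beyond[OF v'] True by (simp add: uwalk_Suc[OF q_def])
  next
    case False
    then show ?thesis using Suc.IH[OF v', of "F(q := Suc (F q))"]
      by (simp add: uwalk_Suc[OF q_def] fun_upd_def)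
  qed
qed simp

text \<open>Counters above the current layer are neither read nor written, so changing one commutes
  with the rest of the walk. The undoing argument needs this to handle the first counter separately
  from the remaining walk.\<close>

lemma rwalk_fun_upd:
  assumes "v \<in> V" "x > i * n + n"
  shows "rwalk M a e i v (F(x := c)) = (fst (rwalk M a e i v F), (snd (rwalk M a e i v F))(x := c))"
  using assms
proof (induction i arbitrary: v F)
  case (Suc i)
  define q where "q = Suc i * n + v"
  have "x \<noteq> q" using Suc.prems V_iff q_def by auto
  define w where "w = next_vertex I v ((F q + a) mod M)"
  define F' where "F' = F(q := ((F q + a) mod M + e) mod M)"
  have w: "w \<in> V" unfolding w_def using Suc.prems(1) by (rule next_vertex_in_V)
  have "rwalk M a e (Suc i) v (F(x := c)) = rwalk M a e i w (F'(x := c))"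
    using \<open>x \<noteq> q\<close> by (simp add: rwalk_Suc[OF q_def] w_def F'_def fun_upd_twist)
  also have "\<dots> = (fst (rwalk M a e i w F'), (snd (rwalk M a e i w F'))(x := c))"
    using Suc.prems by (intro Suc.IH w) simp
  also have "rwalk M a e i w F' = rwalk M a e (Suc i) v F"
    by (simp add: rwalk_Suc[OF q_def] w_def F'_def)
  finally show ?case .
qed simp

text \<open>The forward walk reads a counter and then increments it; the undoing walk decrements
  first and hence reads the same value, takes the same arc and leaves the old value behind. The
  remaining walk does not see this counter, so induction applies to it.\<close>

lemma rwalk_undo:
  assumes "v \<in> V" "M > 0" "\<And>q. F q < M"
  shows "rwalk M (M - 1) 0 i v (snd (rwalk M 0 1 i v F)) = (fst (rwalk M 0 1 i v F), F)"
  using assms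
proof (induction i arbitrary: v F)
  case (Suc i)
  define q where "q = Suc i * n + v"
  define w where "w = next_vertex I v (F q)"
  have w: "w \<in> V" unfolding w_def using Suc.prems(1) by (rule next_vertex_in_V)
  have big: "q > i * n + n" using Suc.prems V_iff q_def by auto
  define H where "H = rwalk M 0 1 i w F"
  have fwd: "rwalk M 0 1 (Suc i) v F = (fst H, (snd H)(q := Suc (F q) mod M))"
    using Suc.prems rwalk_fun_upd[OF w big, of M 0 1 F]
    by (simp add: rwalk_Suc[OF q_def] H_def w_def)
  \<comment> \<open>Decrementing is expressed as adding \<open>M - 1\<close>, which avoids truncated
    subtraction at 0.\<close>
  have "(Suc (F q) mod M + (M - 1)) mod M = (Suc (F q) + (M - 1)) mod M" by (simp add: mod_add_left_eq)
  also have "\<dots> = F q" using Suc.prems by simp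
  finally have dec: "(Suc (F q) mod M + (M - 1)) mod M = F q" .
  have "rwalk M (M - 1) 0 (Suc i) v ((snd H)(q := Suc (F q) mod M)) =
      rwalk M (M - 1) 0 i w ((snd H)(q := F q))"
    using Suc.prems dec by (simp add: rwalk_Suc[OF q_def] w_def)
  also have "\<dots> = (fst H, F(q := F q))"
    using rwalk_fun_upd[OF w big, of M "M - 1" 0 "snd H" "F q"] Suc.IH[OF w Suc.prems(2,3)]
    by (simp add: H_def)
  finally show ?case unfolding fwd fst_conv snd_conv fun_upd_triv .
qed simp

lemma rwalk_less:
  assumes "M > 0" "\<And>q. F q < M"
  shows "snd (rwalk M a e i v F) q < M"
  using assms
proof (induction i arbitrary: v F)
  case (Suc i)
  show ?case unfolding rwalk_Suc[OF refl] by (rule Suc.IH) (use Suc.prems in auto)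
qed simp

section \<open>The potential and its bounds\<close>

definition drift :: "nat \<Rightarrow> nat \<Rightarrow> nat \<Rightarrow> real" where
  "drift i v r = hit I i (next_vertex I v r) - hit I (Suc i) v"

text \<open>The potential depends on the counter value alone: the initial contents are treated as if
  the rotor had already made that many turns from 0. The argument \<open>c\<close> is not reduced,
  and \<open>r mod M\<close> records the jump at a wrap-around.\<close>

definition pot :: "nat \<Rightarrow> nat \<Rightarrow> nat \<Rightarrow> nat \<Rightarrow> real" where
  "pot M i v c = (\<Sum>r<c. drift i v (r mod M))"

definition total_pot :: "nat \<Rightarrow> nat \<Rightarrow> (nat \<Rightarrow> nat) \<Rightarrow> real" where
  "total_pot M i F = (\<Sum>j<i. \<Sum>v\<in>V. pot M j v (F (Suc j * n + v)))"

lemma total_pot_upd: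
  assumes "x > i * n + n"
  shows "total_pot M i (F(x := c)) = total_pot M i F"
proof -
  have "Suc j * n + v \<noteq> x" if "j < i" "v \<in> V" for j v
  proof -
    have "Suc j * n \<le> i * n" using that by (intro mult_right_mono) auto
    then show ?thesis using that V_iff assms by fastforce
  qed
  then show ?thesis unfolding total_pot_def by (intro sum.cong) auto
qed

text \<open>At the end of the walk, \<open>hit I 0\<close> is the indicator of the target, so the
  left-hand side is the total change of the hitting probability along the walk. A single step
  changes it by exactly the term that the potential gains from incrementing the counter
  used.\<close>

lemma uwalk_total_pot:
  assumes "v \<in> V"
  shows "of_bool (fst (uwalk M i v F) = target I) - hit I i v =
    total_pot M i (snd (uwalk M i v F)) - total_pot M i F"
  using assms
proof (induction i arbitrary: v F)
  case 0
  then show ?case by (simp add: hit_def total_pot_def pmf_return indicator_def)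
next
  case (Suc i)
  define q where "q = Suc i * n + v"
  define w where "w = next_vertex I v (F q mod M)"
  define F' where "F' = F(q := Suc (F q))"
  define H where "H = uwalk M i w F'"
  have w: "w \<in> V" unfolding w_def using Suc.prems(1) by (rule next_vertex_in_V)
  have big: "q > i * n + n" using Suc.prems V_iff q_def by auto
  have H: "uwalk M (Suc i) v F = H" by (simp add: uwalk_Suc[OF q_def] H_def w_def F'_def)
  have layer: "total_pot M (Suc i) E =
      total_pot M i E + (\<Sum>u\<in>V. pot M i u (E (Suc i * n + u)))" for E
    by (simp add: total_pot_def)
  have "(\<Sum>u\<in>V. pot M i u (snd H (Suc i * n + u))) = (\<Sum>u\<in>V. pot M i u (F' (Suc i * n + u)))"
  proof (rule sum.cong)
    fix u assume "u \<in> V"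
    then have "Suc i * n + u > i * n + n" using V_iff by auto
    then show "pot M i u (snd H (Suc i * n + u)) = pot M i u (F' (Suc i * n + u))"
      unfolding H_def using uwalk_eq_beyond[OF w] by simp
  qed simp
  \<comment> \<open>In the top layer only the counter of \<open>v\<close> moves, by one, which
    appends a single drift term to its potential.\<close>
  moreover have "(\<Sum>u\<in>V. pot M i u (F' (Suc i * n + u))) =
      (\<Sum>u\<in>V. pot M i u (F (Suc i * n + u)) + (if u = v then drift i v (F q mod M) else 0))"
    by (rule sum.cong) (auto simp: F'_def q_def pot_def)
  ultimately have "(\<Sum>u\<in>V. pot M i u (snd H (Suc i * n + u))) =
      (\<Sum>u\<in>V. pot M i u (F (Suc i * n + u))) + (hit I i w - hit I (Suc i) v)"
    using Suc.prems by (simp add: sum.distrib drift_def w_def)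
  moreover have "of_bool (fst H = target I) - hit I i w = total_pot M i (snd H) - total_pot M i F"
    using Suc.IH[OF w, of F'] total_pot_upd[OF big, of M F "Suc (F q)"]
    by (simp add: H_def flip: F'_def)
  ultimately show ?case unfolding H layer by simp
qed

text \<open>Without wrap-around the arcs are taken cyclically from the first one, so the drifts are
  periodic with sum 0 over a period. At a sink every drift vanishes.\<close>

lemma pot_bound_le:
  assumes v: "v \<in> V" and c: "c \<le> M"
  shows "\<bar>pot M i v c\<bar> \<le> deg v"
proof -
  have "pot M i v c = (\<Sum>r<c. drift i v r)"
    unfolding pot_def using c by (intro sum.cong) auto
  moreover have "\<bar>\<Sum>r<c. drift i v r\<bar> \<le> deg v"
  proof (cases "deg v = 0")
    case True
    then show ?thesis by (simp add: drift_def next_vertex_sink hit_Suc(2) v)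
  next
    case False
    show ?thesis
    proof (rule abs_sum_periodic_le)
      show "deg v > 0" using False by simp
      show "drift i v (x + deg v) = drift i v x" for x by (simp add: drift_def next_vertex_def)
      show "(\<Sum>x<deg v. drift i v x) = 0"
        using hit_Suc(1)[OF v, of i] by (simp add: drift_def sum_subtractf)
      show "\<bar>drift i v x\<bar> \<le> 1" for x
        using hit_bounds[of I i "next_vertex I v x"] hit_bounds[of I "Suc i" v]
        by (auto simp: drift_def)
    qed
  qed
  ultimately show ?thesis by simp
qed

text \<open>The wrap-around cuts a turn short and starts again at residue 0, leaving two incomplete
  turns, one from each side of \<open>M\<close>.\<close>

lemma pot_bound_le_2:
  assumes v: "v \<in> V" and c: "c \<le> 2 * M"
  shows "\<bar>pot M i v c\<bar> \<le> 2 * deg v"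
proof (cases "c \<le> M")
  case True
  then show ?thesis using pot_bound_le[OF v, of c M i] by linarith
next
  case False
  then obtain e where e: "c = M + e" by (metis le_add_diff_inverse nat_le_linear)
  have "pot M i v (M + e) = pot M i v M + (\<Sum>r<e. drift i v ((M + r) mod M))"
    unfolding pot_def by (rule sum_lessThan_add)
  also have "(\<Sum>r<e. drift i v ((M + r) mod M)) = pot M i v e" by (simp add: pot_def)
  finally show ?thesis using pot_bound_le[OF v, of M M i] pot_bound_le[OF v, of e M i] c e by simp
qed

section \<open>Repeated walks\<close>

definition walk_counters :: "nat \<Rightarrow> nat \<Rightarrow> nat \<Rightarrow> (nat \<Rightarrow> nat) \<Rightarrow> nat \<Rightarrow> nat" where
  "walk_counters M a e F = snd (rwalk M a e (steps I) (source I) F)"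

definition hit_count :: "nat \<Rightarrow> nat \<Rightarrow> nat \<Rightarrow> nat \<Rightarrow> (nat \<Rightarrow> nat) \<Rightarrow> nat" where
  "hit_count M a e K F =
     (\<Sum>k<K. of_bool (fst (rwalk M a e (steps I) (source I) ((walk_counters M a e ^^ k) F)) = target I))"

lemma walk_counters_less:
  assumes "M > 0" "\<And>q. F q < M"
  shows "(walk_counters M a e ^^ k) F q < M"
proof (induction k arbitrary: q)
  case (Suc k)
  show ?case unfolding funpow.simps comp_def walk_counters_def
    by (rule rwalk_less) (use assms Suc in \<open>auto simp: walk_counters_def\<close>)
qed (simp add: assms)

text \<open>Regrouping the iterates makes the first undoing walk meet the last forward walk; this
  pair cancels and the induction hypothesis removes the others.\<close>

lemma walk_counters_undo:
  assumes "M > 0" "\<And>q. F q < M"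
  shows "(walk_counters M (M - 1) 0 ^^ K) ((walk_counters M 0 1 ^^ K) F) = F"
proof (induction K)
  case (Suc K)
  have "walk_counters M (M - 1) 0 (walk_counters M 0 1 E) = E" if "\<And>q. E q < M" for E
    using rwalk_undo[OF source_in_V assms(1) that, of "steps I"] by (simp add: walk_counters_def)
  from this[of "(walk_counters M 0 1 ^^ K) F"] walk_counters_less[OF assms, where a = 0 and e = 1 and k = K] show ?case
    using Suc funpow_swap1[of "walk_counters M 0 1" K F] by (simp only: funpow.simps(2)[of _ "walk_counters M 0 1"] funpow_Suc_right[of _ "walk_counters M (M - 1) 0"]
        comp_apply)
qed simp

text \<open>The single-walk identities telescope, so the error is the potential of the final
  contents minus that of the initial ones. Initially counters are below \<open>M\<close>, which
  costs one out-degree each; by \<open>K \<le> M\<close> they end at no more than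
  \<open>2 * M\<close>, which costs two. Out-degrees add up to the number of arcs in each of the
  layers.\<close>

lemma hit_count_error:
  assumes K: "K \<le> M" and F: "\<And>q. F q < M"
  shows "\<bar>real (hit_count M 0 1 K F) - K * hit I (steps I) (source I)\<bar>
    \<le> 3 * real (card (arcs G)) * real (steps I)"
proof -
  let ?T = "steps I" and ?s = "source I" and ?t = "target I"
  define E where "E k = ((\<lambda>E. snd (uwalk M ?T ?s E)) ^^ k) F" for k
  have E0: "E 0 = F" and ES: "E (Suc k) = snd (uwalk M ?T ?s (E k))" for k
    by (simp_all add: E_def)
  have cnt: "(walk_counters M 0 1 ^^ k) F = (\<lambda>q. E k q mod M)" for k
  proof (induction k)
    case (Suc k)
    then show ?case by (simp add: walk_counters_def rwalk_uwalk[unfolded One_nat_def] ES)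
  qed (simp add: E0 F)
  have step: "of_bool (fst (uwalk M ?T ?s (E k)) = ?t) - hit I ?T ?s =
      total_pot M ?T (E (Suc k)) - total_pot M ?T (E k)" for k
    unfolding ES by (rule uwalk_total_pot[OF source_in_V])
  have "real (hit_count M 0 1 K F) - K * hit I ?T ?s =
      (\<Sum>k<K. of_bool (fst (uwalk M ?T ?s (E k)) = ?t) - hit I ?T ?s)"
    unfolding hit_count_def cnt rwalk_uwalk by (simp add: sum_subtractf)
  also have "\<dots> = total_pot M ?T (E K) - total_pot M ?T F"
    unfolding step using sum_lessThan_telescope[of "\<lambda>k. total_pot M ?T (E k)" K] by (simp add: E0)
  finally have eq: "real (hit_count M 0 1 K F) - K * hit I ?T ?s =
      total_pot M ?T (E K) - total_pot M ?T F" .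
  have EK: "E k q \<le> F q + k" for k q
  proof (induction k)
    case (Suc k)
    then show ?case using uwalk_le_Suc[OF source_in_V, of "E k" q M ?T] by (simp add: ES)
  qed (simp add: E0)
  have deg: "(\<Sum>j<?T. \<Sum>v\<in>V. real (deg v)) = card (arcs G) * real ?T"
    using sum_out_degree by (simp flip: of_nat_sum)
  have "\<bar>total_pot M ?T (E K)\<bar> \<le> (\<Sum>j<?T. \<Sum>v\<in>V. \<bar>pot M j v (E K (Suc j * n + v))\<bar>)"
    unfolding total_pot_def by (intro order_trans[OF sum_abs] sum_mono sum_abs)
  also have "\<dots> \<le> (\<Sum>j<?T. \<Sum>v\<in>V. 2 * real (deg v))"
  proof (intro sum_mono)
    fix j v assume "v \<in> V"
    have "E K (Suc j * n + v) \<le> 2 * M" using EK[of K "Suc j * n + v"] F[of "Suc j * n + v"] K by simp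
    then show "\<bar>pot M j v (E K (Suc j * n + v))\<bar> \<le> 2 * real (deg v)"
      using pot_bound_le_2[OF \<open>v \<in> V\<close>] by simp
  qed
  also have "\<dots> = 2 * (card (arcs G) * real ?T)" using deg by (simp flip: sum_distrib_left)
  finally have b1: "\<bar>total_pot M ?T (E K)\<bar> \<le> 2 * (card (arcs G) * real ?T)" .
  have "\<bar>total_pot M ?T F\<bar> \<le> (\<Sum>j<?T. \<Sum>v\<in>V. \<bar>pot M j v (F (Suc j * n + v))\<bar>)"
    unfolding total_pot_def by (intro order_trans[OF sum_abs] sum_mono sum_abs)
  also have "\<dots> \<le> (\<Sum>j<?T. \<Sum>v\<in>V. real (deg v))"
    using F by (intro sum_mono pot_bound_le less_imp_le)
  finally have b2: "\<bar>total_pot M ?T F\<bar> \<le> card (arcs G) * real ?T" unfolding deg .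
  show ?thesis using b1 b2 unfolding eq by (simp add: abs_le_iff)
qed

end

section \<open>Reasoning about programs\<close>

definition fits :: "nat \<Rightarrow> state \<Rightarrow> bool" where
  "fits W \<sigma> \<longleftrightarrow> (\<forall>x. regs \<sigma> x < 2 ^ W) \<and> (\<forall>x\<ge>20. regs \<sigma> x = 0)"

lemma workspace_le:
  assumes "fits W \<sigma>"
  shows "workspace \<sigma> \<le> 20 * W"
proof -
  have sub: "{x. regs \<sigma> x \<noteq> 0} \<subseteq> {..<20}"
  proof
    fix x assume "x \<in> {x. regs \<sigma> x \<noteq> 0}"
    then show "x \<in> {..<20}" using assms by (cases "x < 20") (auto simp: fits_def)
  qed
  have "nat (bitlen (int (regs \<sigma> x))) \<le> W" for x
  proof -
    have "int (regs \<sigma> x) < 2 ^ W"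
      using assms unfolding fits_def by (metis of_nat_less_iff of_nat_numeral of_nat_power)
    then have "bitlen (int (regs \<sigma> x)) \<le> int W"
      by (simp add: bitlen_le_iff_power)
    then show ?thesis by simp
  qed
  then have "workspace \<sigma> \<le> (\<Sum>x | regs \<sigma> x \<noteq> 0. W)"
    unfolding workspace_def by (intro sum_mono)
  also have "\<dots> = card {x. regs \<sigma> x \<noteq> 0} * W" by simp
  also have "\<dots> \<le> 20 * W"
    using card_mono[OF _ sub] by (intro mult_right_mono) auto
  finally show ?thesis .
qed

lemma set_reg_simps [simp]:
  "regs (set_reg x a \<sigma>) = (regs \<sigma>)(x := a)"
  "cat_tape (set_reg x a \<sigma>) = cat_tape \<sigma>"
  "out_tape (set_reg x a \<sigma>) = out_tape \<sigma>"
  by (simp_all add: set_reg_def)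

lemma fits_simps [simp]:
  "fits W \<sigma> \<Longrightarrow> x < 20 \<Longrightarrow> a < 2 ^ W \<Longrightarrow> fits W (set_reg x a \<sigma>)"
  "fits W (\<sigma>\<lparr>cat_tape := \<tau>\<rparr>) = fits W \<sigma>"
  "fits W (\<sigma>\<lparr>out_tape := out\<rparr>) = fits W \<sigma>"
  by (auto simp: fits_def)

section \<open>Total correctness with time and space bounds\<close>

definition frame :: "reg set \<Rightarrow> state \<Rightarrow> state \<Rightarrow> bool" where
  "frame X \<sigma> \<sigma>' \<longleftrightarrow> (\<forall>x. x \<notin> X \<longrightarrow> regs \<sigma>' x = regs \<sigma> x)"

text \<open>A Hoare-style judgement for one given start state, so that postconditions may refer to
  the values before the run. The time is only bounded from above, which lets the two arms of a
  branch share one bound.\<close>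

definition runs ::
  "walk_input \<Rightarrow> nat \<Rightarrow> nat \<Rightarrow> prog \<Rightarrow> nat \<Rightarrow> (state \<Rightarrow> bool) \<Rightarrow> state \<Rightarrow> bool" where
  "runs I W A c t Q \<sigma> \<longleftrightarrow> (\<exists>k \<sigma>'. exec I (20 * W) A c \<sigma> k \<sigma>' \<and> k \<le> t \<and> fits W \<sigma>' \<and> Q \<sigma>')"

lemma runs_weaken:
  assumes "runs I W A c t P \<sigma>" "t \<le> t'" "\<And>\<sigma>'. fits W \<sigma>' \<Longrightarrow> P \<sigma>' \<Longrightarrow> Q \<sigma>'"
  shows "runs I W A c t' Q \<sigma>"
  using assms unfolding runs_def by (blast intro: order_trans)

lemma runs_Seq:
  assumes "runs I W A c t P \<sigma>" "\<And>\<sigma>'. fits W \<sigma>' \<Longrightarrow> P \<sigma>' \<Longrightarrow> runs I W A d t' Q \<sigma>'"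
  shows "runs I W A (Seq c d) (t + t') Q \<sigma>"
proof -
  obtain k \<sigma>' where 1: "exec I (20 * W) A c \<sigma> k \<sigma>'" "k \<le> t" "fits W \<sigma>'" "P \<sigma>'"
    using assms(1) by (auto simp: runs_def)
  then obtain l \<sigma>'' where 2: "exec I (20 * W) A d \<sigma>' l \<sigma>''" "l \<le> t'" "fits W \<sigma>''" "Q \<sigma>''"
    using assms(2)[OF 1(3,4)] by (auto simp: runs_def)
  have "k + l \<le> t + t'" using 1 2 by simp
  with exec.Seq[OF 1(1) 2(1)] 2(3,4) show ?thesis unfolding runs_def by blast
qed

lemma runs_Branch:
  assumes "regs \<sigma> x \<noteq> 0 \<Longrightarrow> runs I W A c t Q \<sigma>" "regs \<sigma> x = 0 \<Longrightarrow> runs I W A d t Q \<sigma>"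
  shows "runs I W A (Branch x c d) (Suc t) Q \<sigma>"
proof (cases "regs \<sigma> x = 0")
  case True
  then obtain k \<sigma>' where "exec I (20 * W) A d \<sigma> k \<sigma>'" "k \<le> t" "fits W \<sigma>'" "Q \<sigma>'"
    using assms(2) by (auto simp: runs_def)
  then show ?thesis unfolding runs_def using True exec.BranchFalse Suc_le_mono by blast
next
  case False
  then obtain k \<sigma>' where "exec I (20 * W) A c \<sigma> k \<sigma>'" "k \<le> t" "fits W \<sigma>'" "Q \<sigma>'"
    using assms(1) by (auto simp: runs_def)
  then show ?thesis unfolding runs_def using False exec.BranchTrue Suc_le_mono by blast
qed

text \<open>The index of the invariant is the number of rounds still to come and thus also proves
  termination. Each round costs its body and one test; the final 1 is the failing test.\<close>

lemma runs_While:
  assumes step: "\<And>k \<sigma>. fits W \<sigma> \<Longrightarrow> Inv (Suc k) \<sigma> \<Longrightarrow> regs \<sigma> x \<noteq> 0 \<and> runs I W A c t (Inv k) \<sigma>"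
    and stop: "\<And>\<sigma>. Inv 0 \<sigma> \<Longrightarrow> regs \<sigma> x = 0"
    and init: "fits W \<sigma>" "Inv k \<sigma>"
  shows "runs I W A (While x c) (k * Suc t + 1) (Inv 0) \<sigma>"
  using init
proof (induction k arbitrary: \<sigma>)
  case 0
  then have "exec I (20 * W) A (While x c) \<sigma> 1 \<sigma>" by (intro exec.WhileFalse stop)
  then show ?case using 0 unfolding runs_def by (intro exI[of _ 1] exI[of _ \<sigma>]) simp
next
  case (Suc k)
  obtain l \<sigma>' where 1: "exec I (20 * W) A c \<sigma> l \<sigma>'" "l \<le> t" "fits W \<sigma>'" "Inv k \<sigma>'"
    using step[OF Suc.prems] by (auto simp: runs_def)
  obtain l' \<sigma>'' where 2: "exec I (20 * W) A (While x c) \<sigma>' l' \<sigma>''" "l' \<le> k * Suc t + 1"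
    "fits W \<sigma>''" "Inv 0 \<sigma>''"
    using Suc.IH[OF 1(3,4)] by (auto simp: runs_def)
  have "exec I (20 * W) A (While x c) \<sigma> (Suc (l + l')) \<sigma>''"
    using step[OF Suc.prems] 1(1) 2(1) by (auto intro: exec.WhileTrue)
  moreover have "Suc (l + l') \<le> Suc k * Suc t + 1" using 1(2) 2(2) by simp
  ultimately show ?case unfolding runs_def using 2 by blast
qed

fun block :: "instr list \<Rightarrow> prog" where
  "block [] = Instr (Const 0 0)"
| "block [i] = Instr i"
| "block (i # is) = Seq (Instr i) (block is)"

text \<open>Space is charged after every instruction, so every intermediate state must fit and not
  only the last one. For a concrete block the simplifier can evaluate this symbolically.\<close>

fun block_ok :: "walk_input \<Rightarrow> nat \<Rightarrow> nat \<Rightarrow> instr list \<Rightarrow> state \<Rightarrow> bool" where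
  "block_ok I W A [] \<sigma> = True"
| "block_ok I W A (i # is) \<sigma> =
     (fits W (effect I i \<sigma>) \<and> cat_addresses i \<sigma> \<subseteq> {..<A} \<and> block_ok I W A is (effect I i \<sigma>))"

lemma runs_block:
  assumes "is \<noteq> []" "block_ok I W A is \<sigma>" "Q (fold (effect I) is \<sigma>)"
  shows "runs I W A (block is) (length is) Q \<sigma>"
  using assms
proof (induction "is" arbitrary: \<sigma> rule: block.induct)
  case (2 i)
  then show ?case unfolding runs_def
    by (auto intro!: exI[of _ 1] exI[of _ "effect I i \<sigma>"] exec.Instr workspace_le)
next
  case (3 i j js)
  have "runs I W A (Instr i) 1 (\<lambda>\<sigma>'. \<sigma>' = effect I i \<sigma>) \<sigma>"
    using 3 unfolding runs_def
    by (auto intro!: exI[of _ 1] exI[of _ "effect I i \<sigma>"] exec.Instr workspace_le)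
  then have "runs I W A (Seq (Instr i) (block (j # js))) (1 + length (j # js)) Q \<sigma>"
    by (rule runs_Seq) (use 3 in auto)
  then show ?case by simp
qed simp

section \<open>Counters as blocks of tape bits\<close>

definition counters :: "nat \<Rightarrow> (nat \<Rightarrow> bool) \<Rightarrow> nat \<Rightarrow> nat" where
  "counters b \<tau> q = horner_sum of_bool 2 (map (\<lambda>k. \<tau> (q * b + k)) [0..<b])"

definition tape_of :: "nat \<Rightarrow> (nat \<Rightarrow> nat) \<Rightarrow> nat \<Rightarrow> bool" where
  "tape_of b F x = bit (F (x div b)) (x mod b)"

lemma counters_less: "counters b \<tau> q < 2 ^ b"
  using horner_sum_of_bool_2_less[of "map (\<lambda>k. \<tau> (q * b + k)) [0..<b]"]
  unfolding counters_def by (simp add: nat_less_iff)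

text \<open>Blocks of \<open>b\<close> bits encode all numbers below \<open>2 ^ b\<close>, so every
  tape is a family of counters and restoring the counters restores the tape bit by bit.\<close>

lemma tape_of_counters: "b > 0 \<Longrightarrow> tape_of b (counters b \<tau>) = \<tau>"
  by (rule ext) (simp add: tape_of_def counters_def bit_horner_sum_bit_iff)

lemma tape_of_fun_upd:
  assumes "b > 0"
  shows "tape_of b (F(q := r)) =
    (\<lambda>x. if q * b \<le> x \<and> x < q * b + b then bit r (x - q * b) else tape_of b F x)"
proof
  fix x
  have "x div b = q \<longleftrightarrow> q * b \<le> x \<and> x < q * b + b"
    using assms div_times_less_eq_dividend[of x b] dividend_less_div_times[of b x]
      div_nat_eqI[of b q x] by (auto simp: mult.commute)
  moreover have "x mod b = x - q * b" if "x div b = q"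
    using that using minus_div_mult_eq_mod[of x b] by simp
  ultimately show "tape_of b (F(q := r)) x =
    (if q * b \<le> x \<and> x < q * b + b then bit r (x - q * b) else tape_of b F x)"
    by (auto simp: tape_of_def)
qed

text \<open>The Horner step for reading a number from its highest bit downwards.\<close>

lemma div_power2_step:
  "(a :: nat) div 2 ^ k = 2 * (a div 2 ^ Suc k) + of_bool (bit a k)"
proof -
  have "a div 2 ^ Suc k = a div 2 ^ k div 2" by (metis div_mult2_eq power_Suc2)
  moreover have "x = 2 * (x div 2) + of_bool (odd x)" for x :: nat
    using mult_div_mod_eq[of 2 x] by (simp only: mod_2_eq_odd)
  ultimately show ?thesis by (simp only: bit_iff_odd)
qed

section \<open>The program\<close>

text \<open>Register 0 is never written, it supplies the constant 0.\<close>

abbreviation (input) "rOne \<equiv> Suc 0 :: reg"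
abbreviation (input) "rN \<equiv> 2 :: reg"
abbreviation (input) "rB \<equiv> 3 :: reg"
abbreviation (input) "rM \<equiv> 4 :: reg"
abbreviation (input) "rK \<equiv> 5 :: reg"
abbreviation (input) "rJ \<equiv> 6 :: reg"
abbreviation (input) "rC \<equiv> 7 :: reg"
abbreviation (input) "rI \<equiv> 8 :: reg"
abbreviation (input) "rV \<equiv> 9 :: reg"
abbreviation (input) "rD \<equiv> 10 :: reg"
abbreviation (input) "rR \<equiv> 11 :: reg"
abbreviation (input) "rA \<equiv> 12 :: reg"
abbreviation (input) "rL \<equiv> 13 :: reg"
abbreviation (input) "rX \<equiv> 14 :: reg"
abbreviation (input) "rY \<equiv> 15 :: reg"
abbreviation (input) "rG \<equiv> 16 :: reg"
abbreviation (input) "rH \<equiv> 17 :: reg"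
abbreviation (input) "rP \<equiv> 18 :: reg"
abbreviation (input) "rE \<equiv> 19 :: reg"

section \<open>Reading and writing one counter\<close>

definition read_prog :: prog where
  "read_prog = Seq (block [Const rR 0, Arith Add rL rB 0])
     (While rL (block [Arith Sub rL rL rOne, Arith Add rX rA rL, ReadCat rX rX,
       Arith Add rR rR rR, Arith Add rR rR rX]))"

definition write_prog :: prog where
  "write_prog = Seq (block [Arith Add rY rR 0, Arith Add rL rB 0, Arith Add rX rA 0])
     (While rL (block [Const rH 2, Arith Div rG rY rH, Arith Add rH rG rG, Arith Sub rY rY rH,
       WriteCat rX rY, Arith Add rY rG 0, Arith Add rX rX rOne, Arith Sub rL rL rOne]))"

lemma runs_read:
  assumes \<sigma>: "fits W \<sigma>" "regs \<sigma> 0 = 0" "regs \<sigma> rOne = 1" "regs \<sigma> rB = b" "regs \<sigma> rA = q * b"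
      "cat_tape \<sigma> = tape_of b F"
    and F: "F q < 2 ^ b" and b: "b > 0" "2 ^ b \<le> (2 ^ W :: nat)"
    and A: "Suc q * b \<le> A" "A < 2 ^ W"
  shows "runs I W A read_prog (6 * b + 3)
    (\<lambda>\<sigma>'. frame {rR, rL, rX} \<sigma> \<sigma>' \<and> regs \<sigma>' rR = F q \<and>
      cat_tape \<sigma>' = cat_tape \<sigma> \<and> out_tape \<sigma>' = out_tape \<sigma>) \<sigma>"
proof -
  \<comment> \<open>With \<open>k\<close> bits still unread, the bits read so far form the quotient
    by \<open>2 ^ k\<close>. A round has 5 instructions and a test, giving
    \<open>6 * b\<close>.\<close>
  define Inv where "Inv k \<sigma>' \<longleftrightarrow> frame {rR, rL, rX} \<sigma> \<sigma>' \<and> k \<le> b \<and> regs \<sigma>' rL = k \<and>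
    regs \<sigma>' rR = F q div 2 ^ k \<and> cat_tape \<sigma>' = cat_tape \<sigma> \<and> out_tape \<sigma>' = out_tape \<sigma>" for k \<sigma>'
  have bW: "b < 2 ^ W" using b(2) less_exp[of b] by linarith
  have "runs I W A read_prog (2 + (b * Suc 5 + 1)) (Inv 0) \<sigma>"
    unfolding read_prog_def
  proof (rule runs_Seq)
    show "runs I W A (block [Const rR 0, Arith Add rL rB 0]) 2 (Inv b) \<sigma>"
      by (rule runs_block[THEN runs_weaken])
         (use \<sigma> F bW in \<open>auto simp: Inv_def frame_def div_less\<close>)
    fix \<sigma>' assume "fits W \<sigma>'" "Inv b \<sigma>'"
    then show "runs I W A (While rL (block [Arith Sub rL rL rOne, Arith Add rX rA rL, ReadCat rX rX,
       Arith Add rR rR rR, Arith Add rR rR rX])) (b * Suc 5 + 1) (Inv 0) \<sigma>'"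
    proof (rule runs_While[rotated 2])
      fix k \<sigma> assume fit: "fits W \<sigma>" and inv: "Inv (Suc k) \<sigma>"
      have r: "regs \<sigma> 0 = 0" "regs \<sigma> rOne = 1" "regs \<sigma> rA = q * b" "regs \<sigma> rL = Suc k"
        "regs \<sigma> rR = F q div 2 ^ Suc k" "cat_tape \<sigma> = tape_of b F" "k < b"
        using inv assms by (auto simp: Inv_def frame_def)
      have bit: "tape_of b F (q * b + k) = bit (F q) k" using r by (simp add: tape_of_def)
      have st: "2 * (F q div 2 ^ Suc k) + of_bool (bit (F q) k) = F q div 2 ^ k"
        using div_power2_step[of "F q" k] by simp
      have "F q div 2 ^ k \<le> F q" by (rule div_le_dividend)
      then have lt: "F q div 2 ^ k < 2 ^ W" using F b by linarith
      have "q * b + k < A" using A r by simp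
      then have ad: "q * b + k < 2 ^ W" "q * b + k < A" using A by auto
      have one: "1 < (2::nat) ^ W" using b bW by linarith
      show "regs \<sigma> rL \<noteq> 0 \<and> runs I W A (block [Arith Sub rL rL rOne, Arith Add rX rA rL, ReadCat rX rX,
       Arith Add rR rR rR, Arith Add rR rR rX]) 5 (Inv k) \<sigma>"
      proof (intro conjI)
        show "regs \<sigma> rL \<noteq> 0" using r by simp
        show "runs I W A (block [Arith Sub rL rL rOne, Arith Add rX rA rL, ReadCat rX rX,
       Arith Add rR rR rR, Arith Add rR rR rX]) 5 (Inv k) \<sigma>"
          apply (rule runs_block[THEN runs_weaken])
          using fit r ad bit st lt bW one inv
          by (auto simp: Inv_def frame_def simp del: power_Suc)
      qed
    qed (auto simp: Inv_def)
  qed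
  then show ?thesis by (rule runs_weaken) (auto simp: Inv_def)
qed


lemma runs_write:
  assumes \<sigma>0: "fits W \<sigma>0" "regs \<sigma>0 0 = 0" "regs \<sigma>0 rOne = 1" "regs \<sigma>0 rB = b" "regs \<sigma>0 rA = q * b"
      "regs \<sigma>0 rR = r" "cat_tape \<sigma>0 = tape_of b F"
    and b: "b > 0" "2 * 2 ^ b \<le> (2 ^ W :: nat)"
    and A: "Suc q * b \<le> A" "A < 2 ^ W"
  shows "runs I W A write_prog (9 * b + 4)
    (\<lambda>\<sigma>'. frame {rL, rX, rY, rG, rH} \<sigma>0 \<sigma>' \<and>
      cat_tape \<sigma>' = tape_of b (F(q := r)) \<and> out_tape \<sigma>' = out_tape \<sigma>0) \<sigma>0"
proof -
  \<comment> \<open>Bits are written from the lowest upwards, so the tape is a hybrid: the first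
    \<open>b - k\<close> cells of the block are new, all others old. A round has 8 instructions and
    a test, giving \<open>9 * b\<close>.\<close>
  define Inv where "Inv k \<sigma>' \<longleftrightarrow> frame {rL, rX, rY, rG, rH} \<sigma>0 \<sigma>' \<and> k \<le> b \<and> regs \<sigma>' rL = k \<and>
    regs \<sigma>' rX = q * b + (b - k) \<and> regs \<sigma>' rY = r div 2 ^ (b - k) \<and>
    cat_tape \<sigma>' = (\<lambda>x. if q * b \<le> x \<and> x < q * b + (b - k) then bit r (x - q * b)
      else tape_of b F x) \<and> out_tape \<sigma>' = out_tape \<sigma>0" for k \<sigma>'
  have bW: "b < 2 ^ W" using b(2) less_exp[of b] by linarith
  have two: "2 < (2::nat) ^ W"
  proof -
    have "(2::nat) ^ 1 \<le> 2 ^ b" using b(1) by (intro power_increasing) auto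
    then show ?thesis using b(2) by simp
  qed
  have rW: "r < 2 ^ W" using \<sigma>0 by (auto simp: fits_def)
  have qb: "q * b < 2 ^ W" using A b(1) by simp
  let ?is = "[Const rH 2, Arith Div rG rY rH, Arith Add rH rG rG, Arith Sub rY rY rH,
       WriteCat rX rY, Arith Add rY rG 0, Arith Add rX rX rOne, Arith Sub rL rL rOne]"
  let ?body = "block ?is"
  have "runs I W A write_prog (3 + (b * Suc 8 + 1)) (Inv 0) \<sigma>0"
    unfolding write_prog_def
  proof (rule runs_Seq)
    show "runs I W A (block [Arith Add rY rR 0, Arith Add rL rB 0, Arith Add rX rA 0]) 3 (Inv b) \<sigma>0"
      by (rule runs_block[THEN runs_weaken])
         (use \<sigma>0 bW rW qb in \<open>auto simp: Inv_def frame_def\<close>)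
    fix \<sigma>' assume "fits W \<sigma>'" "Inv b \<sigma>'"
    then show "runs I W A (While rL ?body) (b * Suc 8 + 1) (Inv 0) \<sigma>'"
    proof (rule runs_While[rotated 2])
      fix k \<sigma> assume fit: "fits W \<sigma>" and inv: "Inv (Suc k) \<sigma>"
      define j where "j = b - Suc k"
      have j: "b - k = Suc j" "j < b" using inv by (auto simp: Inv_def j_def)
      define y where "y = r div 2 ^ j"
      have rr: "regs \<sigma> 0 = 0" "regs \<sigma> rOne = 1" "regs \<sigma> rX = q * b + j" "regs \<sigma> rL = Suc k"
        "regs \<sigma> rY = y" "Suc k \<le> b"
        "cat_tape \<sigma> = (\<lambda>x. if q * b \<le> x \<and> x < q * b + j then bit r (x - q * b)
          else tape_of b F x)"
        and out: "out_tape \<sigma> = out_tape \<sigma>0"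
        using inv assms by (auto simp: Inv_def frame_def j_def y_def)
      have ysuc: "y div 2 = r div 2 ^ Suc j"
        unfolding y_def by (metis div_mult2_eq power_Suc2)
      have ybit: "(y \<noteq> 2 * (y div 2)) = bit r j"
        unfolding bit_iff_odd y_def[symmetric] by presburger
      have y: "y < 2 ^ W" unfolding y_def using rW by (meson div_le_dividend le_less_trans)
      then have y2: "y div 2 < 2 ^ W" "2 * (y div 2) < 2 ^ W" "y - 2 * (y div 2) < 2 ^ W" by auto
      have ad: "q * b + j < A" using A j by simp
      then have ad: "q * b + j < A" "Suc (q * b + j) < 2 ^ W" using A by auto
      have upd: "(\<lambda>x. if q * b \<le> x \<and> x < q * b + j then bit r (x - q * b) else tape_of b F x)
          (q * b + j := bit r j) =
        (\<lambda>x. if q * b \<le> x \<and> x < q * b + Suc j then bit r (x - q * b) else tape_of b F x)"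
        by (auto simp: fun_eq_iff less_Suc_eq)
      have y0: "(\<not> y \<le> 2 * (y div 2)) = bit r j" unfolding ybit[symmetric] by presburger
      have kb: "k \<le> b" using rr by simp
      show "regs \<sigma> rL \<noteq> 0 \<and> runs I W A ?body 8 (Inv k) \<sigma>"
      proof (intro conjI)
        show "regs \<sigma> rL \<noteq> 0" using rr by simp
        have kW: "k < 2 ^ W" using rr bW by simp
        show "runs I W A ?body 8 (Inv k) \<sigma>"
        proof (rule runs_block[THEN runs_weaken, where P = "Inv k"])
          show "block_ok I W A ?is \<sigma>"
            using fit rr ad y y2 two kW by (simp flip: mult_2)
          show "Inv k (fold (effect I) ?is \<sigma>)"
            unfolding Inv_def
          proof (intro conjI)
            show "frame {rL, rX, rY, rG, rH} \<sigma>0 (fold (effect I) ?is \<sigma>)"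
              using inv by (simp add: Inv_def frame_def)
          qed (simp_all add: rr kb out upd j ysuc y0[unfolded ysuc] flip: mult_2 del: power_Suc)
        qed auto
      qed
    qed (auto simp: Inv_def)
  qed
  then show ?thesis
    by (rule runs_weaken) (auto simp: Inv_def tape_of_fun_upd[OF b(1)])
qed

text \<open>Remainders are computed as \<open>x - x div y * y\<close>. Registers \<open>rP\<close>
  and \<open>rE\<close> hold the offsets before and after the choice of the arc, so the same code
  walks and undoes. The final branch keeps the vertex when the oracle answered 0.\<close>

definition step_prog :: prog where
  "step_prog = Seq (block [Arith Mul rA rI rN, Arith Add rA rA rV, Arith Mul rA rA rB])
    (Seq read_prog
    (Seq (block [Arith Add rR rR rP, Arith Div rX rR rM, Arith Mul rX rX rM, Arith Sub rR rR rX,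
       OutDegree rD rV, Arith Div rX rR rD, Arith Mul rX rX rD, Arith Sub rX rR rX,
       Arith Add rX rX rOne, OutNeighbor rD rV rX,
       Arith Add rR rR rE, Arith Div rX rR rM, Arith Mul rX rX rM, Arith Sub rR rR rX])
    (Seq write_prog
    (Branch rD (block [Arith Add rV rD 0]) (block [Const rX 0])))))"

definition walk_prog :: prog where
  "walk_prog = Seq (block [Load rV Source, Load rI Steps])
    (While rI (Seq step_prog (block [Arith Sub rI rI rOne])))"

text \<open>With truncated subtraction, \<open>(x - y) + (y - x)\<close> vanishes exactly when
  \<open>x = y\<close>; this is the test for a hit.\<close>

definition walks_prog :: prog where
  "walks_prog = Seq (block [Arith Add rJ rK 0, Const rC 0])
    (While rJ (Seq walk_prog
      (Seq (block [Load rX Target, Arith Sub rY rX rV, Arith Sub rX rV rX, Arith Add rX rX rY])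
      (Seq (Branch rX (block [Const rX 0]) (block [Arith Add rC rC rOne]))
      (block [Arith Sub rJ rJ rOne])))))"

text \<open>The conditions collect what must fit into a word. The factor 2 in \<open>M_le\<close>
  leaves room for a counter plus an offset before reduction.\<close>

locale rotor_machine = rotor_walk +
  fixes W A b :: nat
  assumes b_pos: "b > 0"
    and M_le: "2 * 2 ^ b \<le> (2 ^ W :: nat)"
    and arcs_less: "card (arcs (graph I)) < 2 ^ W"
    and steps_less: "steps I < 2 ^ W"
    and tape_le: "Suc (steps I * n + n) * b \<le> A"
    and tape_less: "A < 2 ^ W"
begin

section \<open>Correctness of the walk programs\<close>

lemma n_less: "n < 2 ^ W"
proof -
  have "n \<le> Suc (steps I * n + n) * 1" by simp
  also have "\<dots> \<le> Suc (steps I * n + n) * b"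
    using b_pos by (intro mult_left_mono) auto
  finally show ?thesis using tape_le tape_less by (meson le_less_trans le_trans)
qed

lemma two_less: "2 < (2::nat) ^ W"
proof -
  have "(2::nat) ^ 1 \<le> 2 ^ b" using b_pos by (intro power_increasing) auto
  then show ?thesis using M_le by simp
qed

lemma deg_less: "v \<in> V \<Longrightarrow> deg v < 2 ^ W"
  using arcs_less member_le_sum[of v V "\<lambda>v. deg v"] sum_out_degree by simp

lemma vertex_less: "v \<in> V \<Longrightarrow> v < 2 ^ W"
  using n_less V_iff by (meson le_less_trans)

definition ready :: "state \<Rightarrow> bool" where
  "ready \<sigma> \<longleftrightarrow> regs \<sigma> 0 = 0 \<and> regs \<sigma> rOne = 1 \<and> regs \<sigma> rN = n \<and> regs \<sigma> rB = b \<and> regs \<sigma> rM = 2 ^ b"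

abbreviation "scratch \<equiv> {rV, rD, rR, rA, rL, rX, rY, rG, rH}"

lemma ready_frame: "ready \<sigma> \<Longrightarrow> frame X \<sigma> \<sigma>' \<Longrightarrow> X \<inter> {0, rOne, rN, rB, rM} = {} \<Longrightarrow> ready \<sigma>'"
  by (auto simp: ready_def frame_def)

text \<open>The time consists of \<open>6 * b + 3\<close> for reading, \<open>9 * b + 4\<close> for
  writing, 3 and 14 for the two arithmetic blocks, and 2 for the branch.\<close>

lemma runs_step:
  assumes \<sigma>: "fits W \<sigma>" "ready \<sigma>" "regs \<sigma> rI = Suc i" "Suc i \<le> steps I" "regs \<sigma> rV = v" "v \<in> V"
      "regs \<sigma> rP = a" "a < 2 ^ b" "regs \<sigma> rE = e" "e < 2 ^ b" "cat_tape \<sigma> = tape_of b F"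
    and F: "\<And>q. F q < 2 ^ b"
    and q_def: "q = Suc i * n + v" and r_def: "r = (F q + a) mod 2 ^ b"
  shows "runs I W A step_prog (15 * b + 26)
    (\<lambda>\<sigma>'. frame scratch \<sigma> \<sigma>' \<and> regs \<sigma>' rV = next_vertex I v r \<and>
      cat_tape \<sigma>' = tape_of b (F(q := (r + e) mod 2 ^ b)) \<and> out_tape \<sigma>' = out_tape \<sigma>) \<sigma>"
proof -
  define w where "w = out_neighbor I v (Suc (r mod deg v))"
  define r' where "r' = (r + e) mod 2 ^ b"
  have rg: "regs \<sigma> 0 = 0" "regs \<sigma> rOne = 1" "regs \<sigma> rN = n" "regs \<sigma> rB = b" "regs \<sigma> rM = 2 ^ b"
    using \<sigma>(2) by (simp_all add: ready_def)
  have qle: "q \<le> steps I * n + n" unfolding q_def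
    using \<sigma>(4,6) V_iff mult_le_mono1[of "Suc i" "steps I" n] by (auto intro: add_mono)
  have "Suc q * b \<le> Suc (steps I * n + n) * b" using qle by (intro mult_right_mono) auto
  then have qA: "Suc q * b \<le> A" using tape_le by linarith
  then have qW: "q * b < 2 ^ W" using tape_less by simp
  have "q \<le> q * b" using b_pos by simp
  then have qW1: "q < 2 ^ W" using qW by (rule le_less_trans)
  then have iW: "Suc i * n < 2 ^ W" by (simp add: q_def)
  have M0: "2 ^ b \<le> (2 ^ W :: nat)" using M_le by linarith
  have Fa: "F q + a < 2 ^ W" using F[of q] \<sigma>(8) M_le by linarith
  have r: "r < 2 ^ b" by (simp add: r_def)
  have re: "r + e < 2 ^ W" using r \<sigma>(10) M_le by linarith
  \<comment> \<open>This includes \<open>y = 0\<close>, where both sides are \<open>x\<close>; thus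
    the program agrees with \<open>next_vertex\<close> at sinks.\<close>
  have rm: "x - x div y * y = x mod y" for x y :: nat by (simp add: minus_div_mult_eq_mod)
  have dm: "x div y * y < 2 ^ W" "x div y < 2 ^ W" if "x < 2 ^ W" for x y :: nat
    using that div_times_less_eq_dividend[of x y] div_le_dividend[of x y] by linarith+
  have rW: "r < 2 ^ W" using r M0 by linarith
  have r1: "Suc (r mod deg v) < 2 ^ W"
    using r M_le mod_less_eq_dividend[of r "deg v"] by linarith
  have wW: "w < 2 ^ W"
  proof -
    have "w = 0 \<or> w = next_vertex I v r" by (simp add: w_def next_vertex_def Let_def)
    then show ?thesis using vertex_less[OF next_vertex_in_V[OF \<sigma>(6)]] by auto
  qed
  have r'W: "r' < 2 ^ W" unfolding r'_def using M0 by (meson le_less_trans less_le_trans mod_less_divisor zero_less_numeral zero_less_power)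
  define Q1 where "Q1 \<sigma>' \<longleftrightarrow> frame {rA} \<sigma> \<sigma>' \<and> regs \<sigma>' rA = q * b \<and>
    cat_tape \<sigma>' = tape_of b F \<and> out_tape \<sigma>' = out_tape \<sigma>" for \<sigma>'
  define Q2 where "Q2 \<sigma>' \<longleftrightarrow> frame {rA, rR, rL, rX} \<sigma> \<sigma>' \<and> regs \<sigma>' rA = q * b \<and> regs \<sigma>' rR = F q \<and>
    cat_tape \<sigma>' = tape_of b F \<and> out_tape \<sigma>' = out_tape \<sigma>" for \<sigma>'
  define Q3 where "Q3 \<sigma>' \<longleftrightarrow> frame {rA, rR, rL, rX, rD} \<sigma> \<sigma>' \<and> regs \<sigma>' rA = q * b \<and>
    regs \<sigma>' rR = r' \<and> regs \<sigma>' rD = w \<and>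
    cat_tape \<sigma>' = tape_of b F \<and> out_tape \<sigma>' = out_tape \<sigma>" for \<sigma>'
  define Q4 where "Q4 \<sigma>' \<longleftrightarrow> frame {rA, rR, rL, rX, rD, rY, rG, rH} \<sigma> \<sigma>' \<and> regs \<sigma>' rD = w \<and>
    cat_tape \<sigma>' = tape_of b (F(q := r')) \<and> out_tape \<sigma>' = out_tape \<sigma>" for \<sigma>'
  define Q5 where "Q5 \<sigma>' \<longleftrightarrow> frame scratch \<sigma> \<sigma>' \<and> regs \<sigma>' rV = next_vertex I v r \<and>
    cat_tape \<sigma>' = tape_of b (F(q := r')) \<and> out_tape \<sigma>' = out_tape \<sigma>" for \<sigma>'
  have "runs I W A step_prog (3 + ((6 * b + 3) + (14 + ((9 * b + 4) + Suc 1)))) Q5 \<sigma>"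
    unfolding step_prog_def
  proof (intro runs_Seq)
    show "runs I W A (block [Arith Mul rA rI rN, Arith Add rA rA rV, Arith Mul rA rA rB]) 3 Q1 \<sigma>"
      by (rule runs_block[THEN runs_weaken])
         (use \<sigma> rg qW qW1 iW in \<open>auto simp: Q1_def frame_def simp flip: q_def simp del: mult_Suc\<close>)
  next
    fix \<sigma>' assume fit: "fits W \<sigma>'" and Q: "Q1 \<sigma>'"
    show "runs I W A read_prog (6 * b + 3) Q2 \<sigma>'"
      by (rule runs_weaken[OF runs_read[where q = q and b = b and F = F]])
         (use fit Q rg F qA M0 tape_less b_pos in \<open>auto simp: Q1_def Q2_def frame_def\<close>)
  next
    fix \<sigma>' assume fit: "fits W \<sigma>'" and Q: "Q2 \<sigma>'"
    have rg': "regs \<sigma>' 0 = 0" "regs \<sigma>' rOne = 1" "regs \<sigma>' rM = 2 ^ b" "regs \<sigma>' rV = v"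
      "regs \<sigma>' rP = a" "regs \<sigma>' rE = e" "regs \<sigma>' rR = F q"
      using Q rg \<sigma> by (auto simp: Q2_def frame_def)
    let ?is = "[Arith Add rR rR rP, Arith Div rX rR rM, Arith Mul rX rX rM, Arith Sub rR rR rX,
       OutDegree rD rV, Arith Div rX rR rD, Arith Mul rX rX rD, Arith Sub rX rR rX,
       Arith Add rX rX rOne, OutNeighbor rD rV rX,
       Arith Add rR rR rE, Arith Div rX rR rM, Arith Mul rX rX rM, Arith Sub rR rR rX]"
    show "runs I W A (block ?is) 14 Q3 \<sigma>'"
    proof (rule runs_block[THEN runs_weaken, where P = Q3])
      have rmod: "r mod deg v < 2 ^ W" using r1 by simp
      show "block_ok I W A ?is \<sigma>'"
        using fit Fa re rW r1 rmod wW r'W dm[OF Fa] dm[OF rW] dm[OF re] deg_less[OF \<sigma>(6)]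
        by (simp add: rg' rm flip: r_def w_def r'_def)
      show "Q3 (fold (effect I) ?is \<sigma>')"
        using Q by (simp add: Q3_def Q2_def frame_def rg' rm flip: r_def w_def r'_def)
    qed auto
  next
    fix \<sigma>' assume fit: "fits W \<sigma>'" and Q: "Q3 \<sigma>'"
    show "runs I W A write_prog (9 * b + 4) Q4 \<sigma>'"
      by (rule runs_weaken[OF runs_write[where q = q and b = b and F = F and r = r']])
         (use fit Q rg qA M_le tape_less b_pos in \<open>auto simp: Q3_def Q4_def frame_def\<close>)
  next
    fix \<sigma>' assume fit: "fits W \<sigma>'" and Q: "Q4 \<sigma>'"
    show "runs I W A (Branch rD (block [Arith Add rV rD 0]) (block [Const rX 0])) (Suc 1) Q5 \<sigma>'"
    proof (rule runs_Branch)
      assume "regs \<sigma>' rD \<noteq> 0"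
      then show "runs I W A (block [Arith Add rV rD 0]) 1 Q5 \<sigma>'"
        by (intro runs_block[THEN runs_weaken, where P = Q5])
           (use fit Q rg wW in \<open>auto simp: Q4_def Q5_def frame_def next_vertex_def w_def\<close>)
    next
      assume "regs \<sigma>' rD = 0"
      then show "runs I W A (block [Const rX 0]) 1 Q5 \<sigma>'"
        by (intro runs_block[THEN runs_weaken, where P = Q5])
           (use fit Q rg \<sigma> in \<open>auto simp: Q4_def Q5_def frame_def next_vertex_def w_def\<close>)
    qed
  qed
  then show ?thesis by (rule runs_weaken) (auto simp: Q5_def r'_def)
qed

lemma runs_walk:
  assumes \<sigma>: "fits W \<sigma>" "ready \<sigma>" "regs \<sigma> rP = a" "a < 2 ^ b" "regs \<sigma> rE = e" "e < 2 ^ b"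
      "cat_tape \<sigma> = tape_of b F"
    and F: "\<And>q. F q < 2 ^ b"
  shows "runs I W A walk_prog (steps I * (15 * b + 28) + 3)
    (\<lambda>\<sigma>'. frame (insert rI scratch) \<sigma> \<sigma>' \<and>
      regs \<sigma>' rV = fst (rwalk (2 ^ b) a e (steps I) (source I) F) \<and>
      cat_tape \<sigma>' = tape_of b (walk_counters (2 ^ b) a e F) \<and> out_tape \<sigma>' = out_tape \<sigma>) \<sigma>"
proof -
  \<comment> \<open>The invariant looks forward: continuing from the current vertex and counters
    yields the same result as the whole walk. No description of the part already walked is
    required.\<close>
  define Inv where "Inv k \<rho> \<longleftrightarrow> frame (insert rI scratch) \<sigma> \<rho> \<and> k \<le> steps I \<and> regs \<rho> rI = k \<and>
    regs \<rho> rV \<in> V \<and> (\<exists>E. (\<forall>q. E q < 2 ^ b) \<and> cat_tape \<rho> = tape_of b E \<and>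
      rwalk (2 ^ b) a e k (regs \<rho> rV) E = rwalk (2 ^ b) a e (steps I) (source I) F) \<and>
    out_tape \<rho> = out_tape \<sigma>" for k \<rho>
  have "runs I W A walk_prog (2 + (steps I * Suc ((15 * b + 26) + 1) + 1)) (Inv 0) \<sigma>"
    unfolding walk_prog_def
  proof (rule runs_Seq)
    show "runs I W A (block [Load rV Source, Load rI Steps]) 2 (Inv (steps I)) \<sigma>"
      by (rule runs_block[THEN runs_weaken, where P = "Inv (steps I)"])
         (use \<sigma> F steps_less source_in_V vertex_less in \<open>auto simp: Inv_def frame_def\<close>)
    fix \<sigma>' assume "fits W \<sigma>'" "Inv (steps I) \<sigma>'"
    then show "runs I W A (While rI (Seq step_prog (block [Arith Sub rI rI rOne])))
      (steps I * Suc ((15 * b + 26) + 1) + 1) (Inv 0) \<sigma>'"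
    proof (rule runs_While[rotated 2])
      fix k \<rho> assume fit: "fits W \<rho>" and inv: "Inv (Suc k) \<rho>"
      define v where "v = regs \<rho> rV"
      obtain E where E: "\<And>q. E q < 2 ^ b" "cat_tape \<rho> = tape_of b E"
        "rwalk (2 ^ b) a e (Suc k) v E = rwalk (2 ^ b) a e (steps I) (source I) F"
        using inv by (auto simp: Inv_def v_def)
      have fr: "frame (insert rI scratch) \<sigma> \<rho>" using inv by (simp add: Inv_def)
      have v: "v \<in> V" using inv by (simp add: Inv_def v_def)
      have k: "Suc k \<le> steps I" "regs \<rho> rI = Suc k" using inv by (simp_all add: Inv_def)
      have out: "out_tape \<rho> = out_tape \<sigma>" using inv by (simp add: Inv_def)
      have rdy: "ready \<rho>" by (rule ready_frame[OF \<sigma>(2) fr]) auto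
      have pe: "regs \<rho> rP = a" "regs \<rho> rE = e" using fr \<sigma> by (auto simp: frame_def)
      define q where "q = Suc k * n + v"
      define r where "r = (E q + a) mod 2 ^ b"
      define E' where "E' = E(q := (r + e) mod 2 ^ b)"
      have E': "E' x < 2 ^ b" for x using E(1) by (simp add: E'_def)
      have nxt: "rwalk (2 ^ b) a e k (next_vertex I v r) E' =
          rwalk (2 ^ b) a e (steps I) (source I) F"
        using E(3) by (simp add: rwalk_Suc[OF q_def] r_def E'_def)
      show "regs \<rho> rI \<noteq> 0 \<and> runs I W A (Seq step_prog (block [Arith Sub rI rI rOne]))
          ((15 * b + 26) + 1) (Inv k) \<rho>"
      proof (intro conjI runs_Seq)
        show "regs \<rho> rI \<noteq> 0" using k by simp
        show "runs I W A step_prog (15 * b + 26)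
          (\<lambda>\<sigma>'. frame scratch \<rho> \<sigma>' \<and> regs \<sigma>' rV = next_vertex I v r \<and>
            cat_tape \<sigma>' = tape_of b E' \<and> out_tape \<sigma>' = out_tape \<rho>) \<rho>"
          unfolding E'_def
          by (rule runs_step[OF fit rdy k(2,1) v_def[symmetric] v pe(1) \<sigma>(4) pe(2) \<sigma>(6) E(2,1) q_def r_def])
        fix \<sigma>' assume fit': "fits W \<sigma>'" and Q: "frame scratch \<rho> \<sigma>' \<and> regs \<sigma>' rV = next_vertex I v r \<and>
            cat_tape \<sigma>' = tape_of b E' \<and> out_tape \<sigma>' = out_tape \<rho>"
        have rg: "regs \<sigma>' rI = Suc k" "regs \<sigma>' rOne = 1"
          using Q k rdy by (auto simp: frame_def ready_def)
        show "runs I W A (block [Arith Sub rI rI rOne]) 1 (Inv k) \<sigma>'"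
        proof (rule runs_block[THEN runs_weaken, where P = "Inv k"])
          show "Inv k (fold (effect I) [Arith Sub rI rI rOne] \<sigma>')"
            unfolding Inv_def
          proof (intro conjI exI[of _ E'])
            show "frame (insert rI scratch) \<sigma> (fold (effect I) [Arith Sub rI rI rOne] \<sigma>')"
              using Q fr by (auto simp: frame_def)
          qed (use Q rg k v nxt E' out next_vertex_in_V in auto)
        qed (use fit' rg k steps_less in auto)
      qed
    qed (auto simp: Inv_def)
  qed
  then show ?thesis
    by (rule runs_weaken) (auto simp: Inv_def walk_counters_def, (metis fst_conv snd_conv)+)
qed

lemma hit_count_Suc:
  "hit_count M a e (Suc k) F = hit_count M a e k F +
    of_bool (fst (rwalk M a e (steps I) (source I) ((walk_counters M a e ^^ k) F)) = target I)"
  by (simp add: hit_count_def)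

text \<open>Keeps the hit register within a word, since the number of walks is.\<close>

lemma hit_count_le: "hit_count M a e k F \<le> k"
  by (induction k) (auto simp: hit_count_Suc hit_count_def)

text \<open>The 11 per walk are 3 for setting up and leaving the step loop, 4 for comparing with the
  target, 2 for the branch, 1 for the loop counter and 1 for the test.\<close>

lemma runs_walks:
  assumes \<sigma>: "fits W \<sigma>" "ready \<sigma>" "regs \<sigma> rP = a" "a < 2 ^ b" "regs \<sigma> rE = e" "e < 2 ^ b"
      "regs \<sigma> rK = K" "cat_tape \<sigma> = tape_of b F"
    and F: "\<And>q. F q < 2 ^ b"
  shows "runs I W A walks_prog (K * (steps I * (15 * b + 28) + 11) + 3)
    (\<lambda>\<sigma>'. frame ({rI, rJ, rC} \<union> scratch) \<sigma> \<sigma>' \<and> regs \<sigma>' rC = hit_count (2 ^ b) a e K F \<and>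
      cat_tape \<sigma>' = tape_of b ((walk_counters (2 ^ b) a e ^^ K) F) \<and> out_tape \<sigma>' = out_tape \<sigma>) \<sigma>"
proof -
  define E where "E k = (walk_counters (2 ^ b) a e ^^ k) F" for k
  define Inv where "Inv k \<rho> \<longleftrightarrow> frame ({rI, rJ, rC} \<union> scratch) \<sigma> \<rho> \<and> k \<le> K \<and> regs \<rho> rJ = k \<and>
    regs \<rho> rC = hit_count (2 ^ b) a e (K - k) F \<and> cat_tape \<rho> = tape_of b (E (K - k)) \<and>
    out_tape \<rho> = out_tape \<sigma>" for k \<rho>
  have E: "E k q < 2 ^ b" for k q
    unfolding E_def by (rule walk_counters_less) (use F in auto)
  have KW: "K < 2 ^ W" using \<sigma> by (auto simp: fits_def)
  let ?T = "steps I * (15 * b + 28)"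
  let ?cmp = "[Load rX Target, Arith Sub rY rX rV, Arith Sub rX rV rX, Arith Add rX rX rY]"
  let ?inc = "Branch rX (block [Const rX 0]) (block [Arith Add rC rC rOne])"
  have "runs I W A walks_prog (2 + (K * Suc ((?T + 3) + (4 + (Suc 1 + 1))) + 1)) (Inv 0) \<sigma>"
    unfolding walks_prog_def
  proof (rule runs_Seq)
    show "runs I W A (block [Arith Add rJ rK 0, Const rC 0]) 2 (Inv K) \<sigma>"
      by (rule runs_block[THEN runs_weaken, where P = "Inv K"])
         (use \<sigma> KW in \<open>auto simp: Inv_def frame_def ready_def E_def hit_count_def\<close>)
    fix \<sigma>' assume "fits W \<sigma>'" "Inv K \<sigma>'"
    then show "runs I W A (While rJ (Seq walk_prog
      (Seq (block ?cmp) (Seq ?inc (block [Arith Sub rJ rJ rOne])))))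
      (K * Suc ((?T + 3) + (4 + (Suc 1 + 1))) + 1) (Inv 0) \<sigma>'"
    proof (rule runs_While[rotated 2])
      fix k \<rho> assume fit: "fits W \<rho>" and inv: "Inv (Suc k) \<rho>"
      define j where "j = K - Suc k"
      have j: "K - k = Suc j" "Suc k \<le> K" "k \<le> K" "j < K" using inv by (auto simp: Inv_def j_def)
      have fr: "frame ({rI, rJ, rC} \<union> scratch) \<sigma> \<rho>" using inv by (simp add: Inv_def)
      have rg: "regs \<rho> rJ = Suc k" "regs \<rho> rC = hit_count (2 ^ b) a e j F"
        "cat_tape \<rho> = tape_of b (E j)" "out_tape \<rho> = out_tape \<sigma>"
        using inv by (simp_all add: Inv_def j_def)
      have rdy: "ready \<rho>" by (rule ready_frame[OF \<sigma>(2) fr]) auto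
      have pe: "regs \<rho> rP = a" "regs \<rho> rE = e" using fr \<sigma> by (auto simp: frame_def)
      define v where "v = fst (rwalk (2 ^ b) a e (steps I) (source I) (E j))"
      have ES: "walk_counters (2 ^ b) a e (E j) = E (Suc j)" by (simp add: E_def)
      define Q1 where "Q1 \<sigma>' \<longleftrightarrow> frame (insert rI scratch) \<rho> \<sigma>' \<and> regs \<sigma>' rV = v \<and>
        cat_tape \<sigma>' = tape_of b (E (Suc j)) \<and> out_tape \<sigma>' = out_tape \<sigma>" for \<sigma>'
      define Q2 where "Q2 \<sigma>' \<longleftrightarrow> frame (insert rI scratch) \<rho> \<sigma>' \<and> (regs \<sigma>' rX = 0 \<longleftrightarrow> v = target I) \<and>
        cat_tape \<sigma>' = tape_of b (E (Suc j)) \<and> out_tape \<sigma>' = out_tape \<sigma>" for \<sigma>'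
      define Q3 where "Q3 \<sigma>' \<longleftrightarrow> frame ({rI, rC} \<union> scratch) \<rho> \<sigma>' \<and>
        regs \<sigma>' rC = hit_count (2 ^ b) a e (Suc j) F \<and>
        cat_tape \<sigma>' = tape_of b (E (Suc j)) \<and> out_tape \<sigma>' = out_tape \<sigma>" for \<sigma>'
      have hc: "hit_count (2 ^ b) a e (Suc j) F = hit_count (2 ^ b) a e j F + of_bool (v = target I)"
        by (simp add: hit_count_Suc v_def E_def)
      have hW: "hit_count (2 ^ b) a e (Suc j) F < 2 ^ W"
        using hit_count_le[of "2 ^ b" a e "Suc j" F] j KW by linarith
      show "regs \<rho> rJ \<noteq> 0 \<and> runs I W A (Seq walk_prog
        (Seq (block ?cmp) (Seq ?inc (block [Arith Sub rJ rJ rOne]))))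
        ((?T + 3) + (4 + (Suc 1 + 1))) (Inv k) \<rho>"
      proof (intro conjI runs_Seq)
        show "regs \<rho> rJ \<noteq> 0" using rg by simp
        show "runs I W A walk_prog (?T + 3) Q1 \<rho>"
          using runs_walk[OF fit rdy pe(1) \<sigma>(4) pe(2) \<sigma>(6) rg(3) E]
          by (rule runs_weaken) (auto simp: Q1_def v_def ES rg)
      next
        fix \<sigma>' assume fit': "fits W \<sigma>'" and Q: "Q1 \<sigma>'"
        have vW: "v < 2 ^ W" using fit' Q by (auto simp: Q1_def fits_def)
        have tW: "target I < 2 ^ W" using target_in_V by (rule vertex_less)
        have rv: "regs \<sigma>' rV = v" using Q by (simp add: Q1_def)
        show "runs I W A (block ?cmp) 4 Q2 \<sigma>'"
        proof (rule runs_block[THEN runs_weaken, where P = Q2])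
          have d: "v - target I < 2 ^ W" "target I - v < 2 ^ W"
            "v - target I + (target I - v) < 2 ^ W" using vW tW by linarith+
          show "block_ok I W A ?cmp \<sigma>'" using fit' tW d by (simp add: rv)
          show "Q2 (fold (effect I) ?cmp \<sigma>')" using Q by (auto simp: Q1_def Q2_def frame_def)
        qed auto
      next
        fix \<sigma>' assume fit': "fits W \<sigma>'" and Q: "Q2 \<sigma>'"
        have rc: "regs \<sigma>' rC = hit_count (2 ^ b) a e j F" "regs \<sigma>' rOne = 1"
          using Q rg rdy by (auto simp: Q2_def frame_def ready_def)
        show "runs I W A ?inc (Suc 1) Q3 \<sigma>'"
        proof (rule runs_Branch)
          assume "regs \<sigma>' rX \<noteq> 0"
          then show "runs I W A (block [Const rX 0]) 1 Q3 \<sigma>'"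
            by (intro runs_block[THEN runs_weaken, where P = Q3])
               (use fit' Q rc hc in \<open>auto simp: Q2_def Q3_def frame_def\<close>)
        next
          assume "regs \<sigma>' rX = 0"
          then show "runs I W A (block [Arith Add rC rC rOne]) 1 Q3 \<sigma>'"
            by (intro runs_block[THEN runs_weaken, where P = Q3])
               (use fit' Q rc hc hW in \<open>auto simp: Q2_def Q3_def frame_def\<close>)
        qed
      next
        fix \<sigma>' assume fit': "fits W \<sigma>'" and Q: "Q3 \<sigma>'"
        have rc: "regs \<sigma>' rJ = Suc k" "regs \<sigma>' rOne = 1"
          using Q rg rdy by (auto simp: Q3_def frame_def ready_def)
        show "runs I W A (block [Arith Sub rJ rJ rOne]) 1 (Inv k) \<sigma>'"
        proof (rule runs_block[THEN runs_weaken, where P = "Inv k"])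
          show "Inv k (fold (effect I) [Arith Sub rJ rJ rOne] \<sigma>')"
            unfolding Inv_def
          proof (intro conjI)
            show "frame ({rI, rJ, rC} \<union> scratch) \<sigma> (fold (effect I) [Arith Sub rJ rJ rOne] \<sigma>')"
              using Q fr by (auto simp: frame_def Q3_def)
          qed (use Q rc j in \<open>auto simp: Q3_def\<close>)
        qed (use fit' rc j KW in auto)
      qed
    qed (auto simp: Inv_def)
  qed
  then show ?thesis
    by (rule runs_weaken) (auto simp: Inv_def E_def add_mult_distrib2 algebra_simps)
qed

end

section \<open>Computing the parameters and assembling the estimator\<close>

definition arcs_prog :: prog where
  "arcs_prog = Seq (block [Load rN NumVerts, Arith Add rV rN 0, Const rX 0])
    (While rV (block [OutDegree rD rV, Arith Add rX rX rD, Arith Sub rV rV rOne]))"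

definition scale_prog :: prog where
  "scale_prog = Seq (block [Const rK 1, CmpEps rG rOne rK, Arith Sub rG rOne rG])
    (While rG (block [Arith Add rK rK rK, CmpEps rG rOne rK, Arith Sub rG rOne rG]))"

definition size_prog :: prog where
  "size_prog = Seq (block [Arith Mul rK rK rX, Load rX Steps, Arith Mul rK rK rX, Const rX 3,
      Arith Mul rK rK rX, Const rM 2, Const rB 1, Arith Sub rG rK rM])
    (While rG (block [Arith Add rM rM rM, Arith Add rB rB rOne, Arith Sub rG rK rM]))"

text \<open>The estimate is emitted between the two passes, because the undoing pass counts its own
  hits in the same register.\<close>

definition main_prog :: prog where
  "main_prog = Seq arcs_prog (Seq scale_prog (Seq size_prog
    (Seq (block [Const rP 0, Const rE 1]) (Seq walks_prog
    (Seq (block [Emit rC, Emit rK, Arith Sub rP rM rOne, Const rE 0]) walks_prog)))))"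

definition no_steps_prog :: prog where
  "no_steps_prog = Seq (block [Load rX Source, Load rY Target, Arith Sub rI rX rY, Arith Sub rX rY rX,
      Arith Add rX rX rI])
    (Seq (Branch rX (block [Emit 0]) (block [Emit rOne])) (block [Emit rOne]))"

text \<open>The case \<open>eps \<ge> 1\<close> comes first because the workspace bound may then be constant, too small even
  for the input; without steps the time bound is constant.\<close>

definition estimator :: prog where
  "estimator = Seq (block [Const rOne 1, CmpEps rX rOne rOne])
    (Branch rX (block [Emit 0, Emit rOne])
      (Seq (block [Load rX Steps]) (Branch rX main_prog no_steps_prog)))"

section \<open>Number of walks and length of counters\<close>

context rotor_walk
begin

definition scale :: nat where
  "scale = (LEAST k. 1 \<le> 2 ^ k * eps I)"

definition num_walks :: nat where
  "num_walks = 3 * (steps I * (card (arcs G) * 2 ^ scale))"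

text \<open>At least one bit, because tape addresses are divided by this length; the search in
  \<open>size_prog\<close> accordingly starts with one bit and modulus 2.\<close>

definition bits :: nat where
  "bits = Suc (LEAST k. num_walks \<le> 2 ^ Suc k)"

lemma scale_ex: "\<exists>k. 1 \<le> 2 ^ k * eps I"
proof -
  obtain k where "1 / eps I < 2 ^ k" using real_arch_pow[of 2 "1 / eps I"] by auto
  then have "1 < 2 ^ k * eps I" using eps_pos by (simp add: pos_divide_less_eq)
  then show ?thesis by (intro exI[of _ k]) simp
qed

lemma scale_le: "1 \<le> 2 ^ scale * eps I"
  unfolding scale_def using scale_ex by (rule LeastI_ex)

text \<open>Minimality in the form of a loop guard: on the way up, the test succeeds for the first
  time at \<open>scale\<close>. \<open>bits_iff\<close> plays the same role for the counter
  length.\<close>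

lemma scale_iff:
  assumes "j \<le> scale"
  shows "1 \<le> 2 ^ j * eps I \<longleftrightarrow> j = scale"
proof (cases "j = scale")
  case False
  then have "j < (LEAST k. 1 \<le> 2 ^ k * eps I)" using assms by (simp add: scale_def)
  then have "\<not> 1 \<le> 2 ^ j * eps I" by (rule not_less_Least)
  then show ?thesis using False by blast
qed (use scale_le in blast)

lemma bits_le: "num_walks \<le> 2 ^ bits"
proof -
  have "num_walks \<le> 2 ^ Suc num_walks" using less_exp[of "Suc num_walks"] by linarith
  then show ?thesis unfolding bits_def by (rule LeastI)
qed

lemma bits_iff:
  assumes "Suc j \<le> bits"
  shows "num_walks \<le> 2 ^ Suc j \<longleftrightarrow> Suc j = bits"
proof (cases "Suc j = bits")
  case False
  then have "j < (LEAST k. num_walks \<le> 2 ^ Suc k)" using assms unfolding bits_def by linarith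
  then have "\<not> num_walks \<le> 2 ^ Suc j" by (rule not_less_Least)
  then show ?thesis using False by blast
qed (use bits_le in simp)

text \<open>By minimality half of \<open>2 ^ bits\<close> is still below \<open>num_walks\<close>,
  unless the search ended at once with modulus 2.\<close>

lemma two_power_bits_le: "2 ^ bits \<le> 2 * num_walks + 2"
proof (cases "bits = 1")
  case False
  then obtain j where j: "bits = Suc (Suc j)" unfolding bits_def
    by (metis One_nat_def not0_implies_Suc)
  then have "\<not> num_walks \<le> 2 ^ Suc j" using bits_iff[of j] by simp
  then show ?thesis by (simp add: j)
qed simp

text \<open>The number of arcs is not part of the readable input and is summed from the out-degrees.
  Partial sums never exceed the total, so they fit into a word.\<close>

lemma runs_arcs:
  assumes \<sigma>: "fits W \<sigma>" "regs \<sigma> 0 = 0" "regs \<sigma> rOne = 1" "cat_tape \<sigma> = \<tau>" "out_tape \<sigma> = []"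
    and W: "n < 2 ^ W" "card (arcs G) < 2 ^ W"
  shows "runs I W A arcs_prog (4 * n + 4)
    (\<lambda>\<sigma>'. regs \<sigma>' 0 = 0 \<and> regs \<sigma>' rOne = 1 \<and> regs \<sigma>' rN = n \<and> regs \<sigma>' rX = card (arcs G) \<and>
      cat_tape \<sigma>' = \<tau> \<and> out_tape \<sigma>' = []) \<sigma>"
proof -
  define Inv where "Inv k \<rho> \<longleftrightarrow> regs \<rho> 0 = 0 \<and> regs \<rho> rOne = 1 \<and> regs \<rho> rN = n \<and> k \<le> n \<and>
      regs \<rho> rV = k \<and> regs \<rho> rX = (\<Sum>v\<in>{k<..n}. deg v) \<and> cat_tape \<rho> = \<tau> \<and> out_tape \<rho> = []" for k and \<rho> :: state
  have all: "(\<Sum>v\<in>{0<..n}. deg v) = card (arcs G)"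
  proof -
    have "{0<..n} = V" by (rule set_eqI) (simp only: V_iff greaterThanAtMost_iff One_nat_def Suc_le_eq)
    then show ?thesis by (simp only: sum_out_degree)
  qed
  let ?is = "[OutDegree rD rV, Arith Add rX rX rD, Arith Sub rV rV rOne]"
  have "runs I W A arcs_prog (3 + (n * Suc 3 + 1)) (Inv 0) \<sigma>"
    unfolding arcs_prog_def
  proof (rule runs_Seq)
    show "runs I W A (block [Load rN NumVerts, Arith Add rV rN 0, Const rX 0]) 3 (Inv n) \<sigma>"
      by (rule runs_block[THEN runs_weaken, where P = "Inv n"])
         (use \<sigma> W in \<open>auto simp: Inv_def\<close>)
    fix \<sigma>' assume "fits W \<sigma>'" "Inv n \<sigma>'"
    then show "runs I W A (While rV (block ?is)) (n * Suc 3 + 1) (Inv 0) \<sigma>'"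
    proof (rule runs_While[rotated 2])
      fix k \<rho> assume fit: "fits W \<rho>" and inv: "Inv (Suc k) \<rho>"
      define D where "D = (\<Sum>v\<in>{Suc k<..n}. deg v)"
      have k: "Suc k \<le> n" using inv by (simp add: Inv_def)
      have "{k<..n} = insert (Suc k) {Suc k<..n}" using k by auto
      then have S: "(\<Sum>v\<in>{k<..n}. deg v) = D + deg (Suc k)" by (simp add: D_def)
      have "(\<Sum>v\<in>{k<..n}. deg v) \<le> (\<Sum>v\<in>{0<..n}. deg v)" by (rule sum_mono2) auto
      then have lt: "D + deg (Suc k) < 2 ^ W" "deg (Suc k) < 2 ^ W" "k < 2 ^ W"
        unfolding S all using W k by linarith+
      have rg: "regs \<rho> 0 = 0" "regs \<rho> rOne = 1" "regs \<rho> rN = n" "regs \<rho> rV = Suc k"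
        "regs \<rho> rX = D" "cat_tape \<rho> = \<tau>" "out_tape \<rho> = []"
        using inv by (simp_all add: Inv_def D_def)
      show "regs \<rho> rV \<noteq> 0 \<and> runs I W A (block ?is) 3 (Inv k) \<rho>"
      proof
        show "runs I W A (block ?is) 3 (Inv k) \<rho>"
          by (rule runs_block[THEN runs_weaken, where P = "Inv k"])
             (use fit lt k in \<open>simp_all add: Inv_def S rg\<close>)
      qed (simp add: rg)
    qed (auto simp: Inv_def)
  qed
  then show ?thesis by (rule runs_weaken) (auto simp: Inv_def all)
qed

lemma runs_scale:
  assumes \<sigma>: "fits W \<sigma>" "regs \<sigma> 0 = 0" "regs \<sigma> rOne = 1" "regs \<sigma> rN = n" "regs \<sigma> rX = m"
      "cat_tape \<sigma> = \<tau>" "out_tape \<sigma> = []"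
    and W: "2 ^ scale < (2 ^ W :: nat)" "2 < (2 :: nat) ^ W"
  shows "runs I W A scale_prog (4 * scale + 4)
    (\<lambda>\<sigma>'. regs \<sigma>' 0 = 0 \<and> regs \<sigma>' rOne = 1 \<and> regs \<sigma>' rN = n \<and> regs \<sigma>' rX = m \<and>
      regs \<sigma>' rK = 2 ^ scale \<and> cat_tape \<sigma>' = \<tau> \<and> out_tape \<sigma>' = []) \<sigma>"
proof -
  define Inv where "Inv k \<rho> \<longleftrightarrow> regs \<rho> 0 = 0 \<and> regs \<rho> rOne = 1 \<and> regs \<rho> rN = n \<and> regs \<rho> rX = m \<and>
      k \<le> scale \<and> regs \<rho> rK = 2 ^ (scale - k) \<and> regs \<rho> rG = of_bool (k \<noteq> 0) \<and>
      cat_tape \<rho> = \<tau> \<and> out_tape \<rho> = []" for k and \<rho> :: state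
  let ?is = "[Arith Add rK rK rK, CmpEps rG rOne rK, Arith Sub rG rOne rG]"
  have one: "1 < (2::nat) ^ W" using W by linarith
  have "runs I W A scale_prog (3 + (scale * Suc 3 + 1)) (Inv 0) \<sigma>"
    unfolding scale_prog_def
  proof (rule runs_Seq)
    show "runs I W A (block [Const rK 1, CmpEps rG rOne rK, Arith Sub rG rOne rG]) 3 (Inv scale) \<sigma>"
      by (rule runs_block[THEN runs_weaken, where P = "Inv scale"])
         (use \<sigma> one scale_iff[of 0] in \<open>auto simp: Inv_def\<close>)
    fix \<sigma>' assume "fits W \<sigma>'" "Inv scale \<sigma>'"
    then show "runs I W A (While rG (block ?is)) (scale * Suc 3 + 1) (Inv 0) \<sigma>'"
    proof (rule runs_While[rotated 2])
      fix k \<rho> assume fit: "fits W \<rho>" and inv: "Inv (Suc k) \<rho>"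
      define j where "j = scale - Suc k"
      have j: "scale - k = Suc j" "Suc j \<le> scale" using inv by (auto simp: Inv_def j_def)
      have "(2::nat) ^ Suc j \<le> 2 ^ scale" using j by (intro power_increasing) auto
      then have lt: "(2::nat) ^ Suc j < 2 ^ W" using W by linarith
      have K: "regs \<rho> rK = 2 ^ j" using inv by (simp add: Inv_def j_def)
      have cmp: "1 \<le> 2 * 2 ^ j * eps I \<longleftrightarrow> k = 0"
        using scale_iff[OF j(2)] j by auto
      show "regs \<rho> rG \<noteq> 0 \<and> runs I W A (block ?is) 3 (Inv k) \<rho>"
      proof
        show "runs I W A (block ?is) 3 (Inv k) \<rho>"
        proof (rule runs_block[THEN runs_weaken, where P = "Inv k"])
          have rg: "regs \<rho> 0 = 0" "regs \<rho> rOne = 1" "regs \<rho> rN = n" "regs \<rho> rX = m"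
            "cat_tape \<rho> = \<tau>" "out_tape \<rho> = []"
            using inv by (simp_all add: Inv_def)
          have k: "k \<le> scale" using j by simp
          show "block_ok I W A ?is \<rho>" using fit lt one by (simp add: K rg flip: mult_2)
          show "Inv k (fold (effect I) ?is \<rho>)"
            using k by (simp add: Inv_def rg K j cmp flip: mult_2)
        qed auto
      qed (use inv in \<open>simp add: Inv_def\<close>)
    qed (auto simp: Inv_def)
  qed
  then show ?thesis by (rule runs_weaken) (auto simp: Inv_def)
qed

lemma runs_size:
  assumes \<sigma>: "fits W \<sigma>" "regs \<sigma> 0 = 0" "regs \<sigma> rOne = 1" "regs \<sigma> rN = n"
      "regs \<sigma> rX = card (arcs G)" "regs \<sigma> rK = 2 ^ scale" "cat_tape \<sigma> = \<tau>" "out_tape \<sigma> = []"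
    and T: "steps I > 0" "steps I < 2 ^ W" and W: "2 * 2 ^ bits \<le> (2 ^ W :: nat)"
  shows "runs I W A size_prog (4 * bits + 9)
    (\<lambda>\<sigma>'. regs \<sigma>' 0 = 0 \<and> regs \<sigma>' rOne = 1 \<and> regs \<sigma>' rN = n \<and> regs \<sigma>' rB = bits \<and>
      regs \<sigma>' rM = 2 ^ bits \<and> regs \<sigma>' rK = num_walks \<and> cat_tape \<sigma>' = \<tau> \<and> out_tape \<sigma>' = []) \<sigma>"
proof -
  define B where "B = (LEAST k. num_walks \<le> 2 ^ Suc k)"
  have B: "bits = Suc B" by (simp add: bits_def B_def)
  define Inv where "Inv k \<rho> \<longleftrightarrow> regs \<rho> 0 = 0 \<and> regs \<rho> rOne = 1 \<and> regs \<rho> rN = n \<and> k \<le> B \<and>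
      regs \<rho> rB = bits - k \<and> regs \<rho> rM = 2 ^ (bits - k) \<and> regs \<rho> rK = num_walks \<and>
      regs \<rho> rG = num_walks - 2 ^ (bits - k) \<and> cat_tape \<rho> = \<tau> \<and> out_tape \<rho> = []" for k and \<rho> :: state
  have bW: "bits < 2 ^ W" using W less_exp[of bits] by linarith
  have four: "4 \<le> (2::nat) ^ W"
  proof -
    have "(2::nat) ^ 1 \<le> 2 ^ bits" unfolding B by (intro power_increasing) auto
    then show ?thesis using W by simp
  qed
  have kW: "num_walks < 2 ^ W" using bits_le W zero_less_power[of "2::nat" bits] by linarith
  define m where "m = card (arcs G)"
  have nw: "num_walks = 3 * (steps I * (m * 2 ^ scale))" by (simp add: num_walks_def m_def)
  define p where "p = 2 ^ scale * m"
  \<comment> \<open>A positive number of steps keeps the intermediate products below the final one,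
    and that is at most \<open>2 ^ bits\<close>.\<close>
  have "p \<le> p * steps I" using T by simp
  moreover have p3: "p * steps I * 3 = num_walks" by (simp add: nw p_def mult_ac)
  ultimately have prod: "2 ^ scale * m < 2 ^ W" "2 ^ scale * m * steps I < 2 ^ W"
    "2 ^ scale * m * steps I * 3 < 2 ^ W" "2 ^ scale * m * steps I * 3 = num_walks"
    using kW unfolding p_def[symmetric] by linarith+
  let ?is = "[Arith Add rM rM rM, Arith Add rB rB rOne, Arith Sub rG rK rM]"
  let ?init = "[Arith Mul rK rK rX, Load rX Steps, Arith Mul rK rK rX, Const rX 3,
      Arith Mul rK rK rX, Const rM 2, Const rB 1, Arith Sub rG rK rM]"
  have "runs I W A size_prog (8 + (B * Suc 3 + 1)) (Inv 0) \<sigma>"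
    unfolding size_prog_def
  proof (rule runs_Seq)
    show "runs I W A (block ?init) 8 (Inv B) \<sigma>"
    proof (rule runs_block[THEN runs_weaken, where P = "Inv B"])
      have c: "3 < (2::nat) ^ W" "2 < (2::nat) ^ W" "1 < (2::nat) ^ W" "num_walks - 2 < 2 ^ W"
        using four kW by linarith+
      show "block_ok I W A ?init \<sigma>"
        using \<sigma> prod c kW T by (simp flip: m_def)
      show "Inv B (fold (effect I) ?init \<sigma>)"
        using \<sigma> prod B by (simp add: Inv_def flip: m_def)
    qed auto
    fix \<sigma>' assume "fits W \<sigma>'" "Inv B \<sigma>'"
    then show "runs I W A (While rG (block ?is)) (B * Suc 3 + 1) (Inv 0) \<sigma>'"
    proof (rule runs_While[rotated 2])
      fix k \<rho> assume fit: "fits W \<rho>" and inv: "Inv (Suc k) \<rho>"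
      define j where "j = B - Suc k"
      have j: "bits - k = Suc (Suc j)" "bits - Suc k = Suc j" "Suc j < bits" "Suc k \<le> B"
        using inv by (auto simp: Inv_def j_def B)
      have "(2::nat) ^ Suc (Suc j) \<le> 2 ^ bits" using j by (intro power_increasing) auto
      then have lt: "2 * (2 * 2 ^ j) < (2::nat) ^ W"
        using W zero_less_power[of "2::nat" bits] unfolding power_Suc by linarith
      have le: "\<not> num_walks \<le> 2 ^ Suc j" using bits_iff[of j] j by simp
      have rg: "regs \<rho> rM = 2 ^ Suc j" "regs \<rho> rB = Suc j" "regs \<rho> rK = num_walks" "regs \<rho> rOne = 1"
        "regs \<rho> rG = num_walks - 2 ^ Suc j"
        using inv by (simp_all add: Inv_def j)
      show "regs \<rho> rG \<noteq> 0 \<and> runs I W A (block ?is) 3 (Inv k) \<rho>"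
      proof
        show "runs I W A (block ?is) 3 (Inv k) \<rho>"
        proof (rule runs_block[THEN runs_weaken, where P = "Inv k"])
          have c: "Suc (Suc j) < 2 ^ W" "num_walks - 2 * (2 * 2 ^ j) < 2 ^ W"
            using j bW kW by linarith+
          show "block_ok I W A ?is \<rho>" using fit lt c by (simp add: rg flip: mult_2)
          show "Inv k (fold (effect I) ?is \<rho>)"
            using inv j(4) by (simp add: Inv_def j(1,2))
        qed auto
      qed (use rg le in simp)
    qed (use bits_le in \<open>auto simp: Inv_def\<close>)
  qed
  then show ?thesis by (rule runs_weaken) (auto simp: Inv_def B)
qed

text \<open>The doubled product stands for the forward and the undoing pass; 29 collects the
  constant costs of all stages.\<close>

definition main_time :: nat where
  "main_time = 4 * n + 4 * scale + 4 * bits + 2 * (num_walks * (steps I * (15 * bits + 28) + 11)) + 29"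

lemma runs_main:
  assumes machine: "rotor_machine I W A bits"
    and scale: "2 ^ scale < (2 ^ W :: nat)" and T: "steps I > 0"
    and \<sigma>: "fits W \<sigma>" "regs \<sigma> 0 = 0" "regs \<sigma> rOne = 1" "cat_tape \<sigma> = \<tau>" "out_tape \<sigma> = []"
  shows "runs I W A main_prog main_time
    (\<lambda>\<sigma>'. cat_tape \<sigma>' = \<tau> \<and>
      out_tape \<sigma>' = [hit_count (2 ^ bits) 0 1 num_walks (counters bits \<tau>), num_walks]) \<sigma>"
proof -
  interpret rotor_machine I W A bits by (rule machine)
  define F where "F = counters bits \<tau>"
  have F: "F q < 2 ^ bits" for q by (simp add: F_def counters_less)
  have \<tau>: "\<tau> = tape_of bits F" by (simp add: F_def tape_of_counters b_pos)
  define H where "H = (walk_counters (2 ^ bits) 0 1 ^^ num_walks) F"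
  have H: "H q < 2 ^ bits" for q unfolding H_def by (rule walk_counters_less) (use F in auto)
  have undo: "(walk_counters (2 ^ bits) (2 ^ bits - 1) 0 ^^ num_walks) H = F"
    unfolding H_def by (rule walk_counters_undo) (use F in auto)
  define c where "c = hit_count (2 ^ bits) 0 1 num_walks F"
  define base where "base \<rho> \<longleftrightarrow> ready \<rho> \<and> regs \<rho> rK = num_walks" for \<rho> :: state
  have one: "1 < (2::nat) ^ bits" using power_increasing[of 1 bits "2::nat"] b_pos by simp
  have oneW: "1 < (2::nat) ^ W" using two_less by linarith
  let ?w = "num_walks * (steps I * (15 * bits + 28) + 11) + 3"
  define Q1 where "Q1 \<rho> \<longleftrightarrow> regs \<rho> 0 = 0 \<and> regs \<rho> rOne = 1 \<and> regs \<rho> rN = n \<and>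
    regs \<rho> rX = card (arcs G) \<and> cat_tape \<rho> = \<tau> \<and> out_tape \<rho> = []" for \<rho> :: state
  define Q2 where "Q2 \<rho> \<longleftrightarrow> regs \<rho> 0 = 0 \<and> regs \<rho> rOne = 1 \<and> regs \<rho> rN = n \<and>
    regs \<rho> rX = card (arcs G) \<and> regs \<rho> rK = 2 ^ scale \<and> cat_tape \<rho> = \<tau> \<and> out_tape \<rho> = []" for \<rho> :: state
  define Q3 where "Q3 \<rho> \<longleftrightarrow> base \<rho> \<and> cat_tape \<rho> = tape_of bits F \<and> out_tape \<rho> = []" for \<rho> :: state
  define Q4 where "Q4 \<rho> \<longleftrightarrow> base \<rho> \<and> regs \<rho> rP = 0 \<and> regs \<rho> rE = 1 \<and>
    cat_tape \<rho> = tape_of bits F \<and> out_tape \<rho> = []" for \<rho> :: state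
  define Q5 where "Q5 \<rho> \<longleftrightarrow> base \<rho> \<and> regs \<rho> rC = c \<and>
    cat_tape \<rho> = tape_of bits H \<and> out_tape \<rho> = []" for \<rho> :: state
  define Q6 where "Q6 \<rho> \<longleftrightarrow> base \<rho> \<and> regs \<rho> rP = 2 ^ bits - 1 \<and> regs \<rho> rE = 0 \<and>
    cat_tape \<rho> = tape_of bits H \<and> out_tape \<rho> = [c, num_walks]" for \<rho> :: state
  define Q7 where "Q7 \<rho> \<longleftrightarrow> cat_tape \<rho> = tape_of bits F \<and> out_tape \<rho> = [c, num_walks]" for \<rho> :: state
  have "runs I W A main_prog ((4 * n + 4) + ((4 * scale + 4) + ((4 * bits + 9) + (2 + (?w + (4 + ?w)))))) Q7 \<sigma>"
    unfolding main_prog_def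
  proof (intro runs_Seq)
    show "runs I W A arcs_prog (4 * n + 4) Q1 \<sigma>"
      unfolding Q1_def using \<sigma> n_less arcs_less by (intro runs_arcs)
  next
    fix \<rho> assume "fits W \<rho>" "Q1 \<rho>"
    then show "runs I W A scale_prog (4 * scale + 4) Q2 \<rho>"
      unfolding Q1_def Q2_def using scale two_less by (intro runs_scale) auto
  next
    fix \<rho> assume "fits W \<rho>" "Q2 \<rho>"
    then have "runs I W A size_prog (4 * bits + 9) (\<lambda>\<sigma>'. regs \<sigma>' 0 = 0 \<and> regs \<sigma>' rOne = 1 \<and>
      regs \<sigma>' rN = n \<and> regs \<sigma>' rB = bits \<and> regs \<sigma>' rM = 2 ^ bits \<and> regs \<sigma>' rK = num_walks \<and>
      cat_tape \<sigma>' = \<tau> \<and> out_tape \<sigma>' = []) \<rho>"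
      unfolding Q2_def using T steps_less M_le by (intro runs_size) auto
    then show "runs I W A size_prog (4 * bits + 9) Q3 \<rho>"
      by (rule runs_weaken) (auto simp: Q3_def base_def ready_def \<tau>)
  next
    fix \<rho> assume "fits W \<rho>" "Q3 \<rho>"
    then show "runs I W A (block [Const rP 0, Const rE 1]) 2 Q4 \<rho>"
      by (intro runs_block[THEN runs_weaken, where P = Q4])
         (use oneW in \<open>auto simp: Q3_def Q4_def base_def ready_def\<close>)
  next
    fix \<rho> assume fit: "fits W \<rho>" and Q: "Q4 \<rho>"
    show "runs I W A walks_prog ?w Q5 \<rho>"
    proof (rule runs_weaken)
      show "runs I W A walks_prog ?w (\<lambda>\<sigma>'. frame ({rI, rJ, rC} \<union> scratch) \<rho> \<sigma>' \<and>
        regs \<sigma>' rC = hit_count (2 ^ bits) 0 1 num_walks F \<and>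
        cat_tape \<sigma>' = tape_of bits ((walk_counters (2 ^ bits) 0 1 ^^ num_walks) F) \<and>
        out_tape \<sigma>' = out_tape \<rho>) \<rho>"
        by (rule runs_walks) (use fit Q F one in \<open>auto simp: Q4_def base_def\<close>)
      fix \<sigma>'
      assume R: "frame ({rI, rJ, rC} \<union> scratch) \<rho> \<sigma>' \<and>
        regs \<sigma>' rC = hit_count (2 ^ bits) 0 1 num_walks F \<and>
        cat_tape \<sigma>' = tape_of bits ((walk_counters (2 ^ bits) 0 1 ^^ num_walks) F) \<and>
        out_tape \<sigma>' = out_tape \<rho>"
      then have "ready \<sigma>'" using ready_frame[of \<rho> "{rI, rJ, rC} \<union> scratch" \<sigma>'] Q
        by (auto simp: Q4_def base_def)
      moreover have "regs \<sigma>' rK = num_walks" using R Q by (auto simp: frame_def Q4_def base_def)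
      ultimately show "Q5 \<sigma>'" using R Q by (simp add: Q5_def Q4_def base_def c_def H_def)
    qed simp
  next
    fix \<rho> assume fit: "fits W \<rho>" and Q: "Q5 \<rho>"
    have "2 ^ bits - 1 < (2::nat) ^ W"
      using M_le zero_less_power[of "2::nat" bits] by linarith
    then show "runs I W A (block [Emit rC, Emit rK, Arith Sub rP rM rOne, Const rE 0]) 4 Q6 \<rho>"
      by (intro runs_block[THEN runs_weaken, where P = Q6])
         (use fit Q in \<open>auto simp: Q5_def Q6_def base_def ready_def\<close>)
  next
    fix \<rho> assume fit: "fits W \<rho>" and Q: "Q6 \<rho>"
    have "runs I W A walks_prog ?w (\<lambda>\<sigma>'. frame ({rI, rJ, rC} \<union> scratch) \<rho> \<sigma>' \<and>
        regs \<sigma>' rC = hit_count (2 ^ bits) (2 ^ bits - 1) 0 num_walks H \<and>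
        cat_tape \<sigma>' = tape_of bits ((walk_counters (2 ^ bits) (2 ^ bits - 1) 0 ^^ num_walks) H) \<and>
        out_tape \<sigma>' = out_tape \<rho>) \<rho>"
      by (rule runs_walks) (use fit Q H in \<open>auto simp: Q6_def base_def\<close>)
    then show "runs I W A walks_prog ?w Q7 \<rho>"
      unfolding undo by (rule runs_weaken) (use Q in \<open>auto simp: Q6_def Q7_def\<close>)
  qed
  then show ?thesis
    by (rule runs_weaken) (auto simp: Q7_def main_time_def c_def F_def[symmetric] simp flip: \<tau>)
qed

section \<open>The estimator in its three cases\<close>

lemma catalytic_runI:
  assumes "runs I W A P t (\<lambda>\<sigma>'. cat_tape \<sigma>' = \<tau> \<and> out_tape \<sigma>' = out) (init_state \<tau>)"
  shows "\<exists>k\<le>t. catalytic_run P I (20 * W) A \<tau> k out"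
  using assms unfolding runs_def catalytic_run_def by blast

lemma init_state_simps [simp]:
  "fits W (init_state \<tau>)" "regs (init_state \<tau>) x = 0" "cat_tape (init_state \<tau>) = \<tau>"
  "out_tape (init_state \<tau>) = []"
  by (simp_all add: init_state_def fits_def)

text \<open>Probabilities lie between 0 and 1, so 0 is accurate enough. All registers hold 0 or 1,
  hence words of one bit suffice.\<close>

lemma estimator_large_eps:
  assumes "eps I \<ge> 1"
  shows "\<exists>k\<le>5. catalytic_run estimator I (20 * 1) 0 \<tau> k [0, 1]"
proof (rule catalytic_runI)
  let ?Q = "\<lambda>\<sigma>'. cat_tape \<sigma>' = \<tau> \<and> out_tape \<sigma>' = [0, 1]"
  define Q where "Q \<rho> \<longleftrightarrow> regs \<rho> 0 = 0 \<and> regs \<rho> rOne = 1 \<and> regs \<rho> rX = 1 \<and> cat_tape \<rho> = \<tau> \<and>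
    out_tape \<rho> = []" for \<rho> :: state
  have "runs I 1 0 estimator (2 + Suc 2) ?Q (init_state \<tau>)"
    unfolding estimator_def
  proof (rule runs_Seq)
    show "runs I 1 0 (block [Const rOne 1, CmpEps rX rOne rOne]) 2 Q (init_state \<tau>)"
      by (rule runs_block[THEN runs_weaken, where P = Q]) (use assms in \<open>auto simp: Q_def\<close>)
    fix \<rho> assume "fits 1 \<rho>" "Q \<rho>"
    then show "runs I 1 0 (Branch rX (block [Emit 0, Emit rOne])
      (Seq (block [Load rX Steps]) (Branch rX main_prog no_steps_prog))) (Suc 2) ?Q \<rho>"
      by (intro runs_Branch runs_block[THEN runs_weaken, where P = ?Q]) (auto simp: Q_def)
  qed
  then show "runs I 1 0 estimator 5 ?Q (init_state \<tau>)" by simp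
qed

lemma estimator_start:
  assumes W: "1 < (2::nat) ^ W" "steps I < 2 ^ W" and eps: "eps I < 1"
    and rest: "\<And>\<rho>. fits W \<rho> \<Longrightarrow> regs \<rho> 0 = 0 \<Longrightarrow> regs \<rho> rOne = 1 \<Longrightarrow> cat_tape \<rho> = \<tau> \<Longrightarrow>
      out_tape \<rho> = [] \<Longrightarrow> runs I W A (if steps I = 0 then no_steps_prog else main_prog) t
        (\<lambda>\<sigma>'. cat_tape \<sigma>' = \<tau> \<and> out_tape \<sigma>' = out) \<rho>"
  shows "\<exists>k\<le>t + 5. catalytic_run estimator I (20 * W) A \<tau> k out"
proof (rule catalytic_runI)
  let ?Q = "\<lambda>\<sigma>'. cat_tape \<sigma>' = \<tau> \<and> out_tape \<sigma>' = out"
  define Q where "Q \<rho> \<longleftrightarrow> regs \<rho> 0 = 0 \<and> regs \<rho> rOne = 1 \<and> regs \<rho> rX = 0 \<and> cat_tape \<rho> = \<tau> \<and>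
    out_tape \<rho> = []" for \<rho> :: state
  define Q' where "Q' \<rho> \<longleftrightarrow> regs \<rho> 0 = 0 \<and> regs \<rho> rOne = 1 \<and> regs \<rho> rX = steps I \<and> cat_tape \<rho> = \<tau> \<and>
    out_tape \<rho> = []" for \<rho> :: state
  have "runs I W A estimator (2 + Suc (1 + Suc t)) ?Q (init_state \<tau>)"
    unfolding estimator_def
  proof (rule runs_Seq)
    show "runs I W A (block [Const rOne 1, CmpEps rX rOne rOne]) 2 Q (init_state \<tau>)"
      by (rule runs_block[THEN runs_weaken, where P = Q]) (use W eps in \<open>auto simp: Q_def\<close>)
    fix \<rho> assume fit: "fits W \<rho>" and Q: "Q \<rho>"
    show "runs I W A (Branch rX (block [Emit 0, Emit rOne])
      (Seq (block [Load rX Steps]) (Branch rX main_prog no_steps_prog))) (Suc (1 + Suc t)) ?Q \<rho>"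
    proof (intro runs_Branch runs_Seq)
      show "runs I W A (block [Load rX Steps]) 1 Q' \<rho>"
        by (rule runs_block[THEN runs_weaken, where P = Q'])
           (use fit Q W in \<open>auto simp: Q_def Q'_def\<close>)
    next
      assume "regs \<rho> rX \<noteq> 0"
      then show "runs I W A (block [Emit 0, Emit rOne]) (1 + Suc t) ?Q \<rho>" using Q by (simp add: Q_def)
    next
      fix \<rho>' assume fit': "fits W \<rho>'" and Q': "Q' \<rho>'"
      have run: "runs I W A (if steps I = 0 then no_steps_prog else main_prog) t ?Q \<rho>'"
        by (rule rest) (use fit' Q' in \<open>simp_all add: Q'_def\<close>)
      have x: "regs \<rho>' rX = steps I" using Q' by (simp add: Q'_def)
      { assume "regs \<rho>' rX \<noteq> 0" then show "runs I W A main_prog t ?Q \<rho>'" using run x by simp }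
      { assume "regs \<rho>' rX = 0" then show "runs I W A no_steps_prog t ?Q \<rho>'" using run x by simp }
    qed
  qed
  then show "runs I W A estimator (t + 5) ?Q (init_state \<tau>)" by (rule runs_weaken) auto
qed

lemma estimator_no_steps:
  assumes eps: "eps I < 1" and T: "steps I = 0" and W: "1 < (2::nat) ^ W" "n < 2 ^ W"
  shows "\<exists>k\<le>13. catalytic_run estimator I (20 * W) 0 \<tau> k [of_bool (source I = target I), 1]"
proof -
  have st: "source I < 2 ^ W" "target I < 2 ^ W"
    using source_in_V target_in_V V_iff W by (meson le_less_trans)+
  let ?Q = "\<lambda>\<sigma>'. cat_tape \<sigma>' = \<tau> \<and> out_tape \<sigma>' = [of_bool (source I = target I), 1]"
  let ?cmp = "[Load rX Source, Load rY Target, Arith Sub rI rX rY, Arith Sub rX rY rX,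
      Arith Add rX rX rI]"
  have "runs I W 0 no_steps_prog (5 + (Suc 1 + 1)) ?Q \<rho>"
    if fit: "fits W \<rho>" and \<rho>: "regs \<rho> 0 = 0" "regs \<rho> rOne = 1" "cat_tape \<rho> = \<tau>" "out_tape \<rho> = []" for \<rho>
  proof -
    define Q where "Q \<rho> \<longleftrightarrow> regs \<rho> 0 = 0 \<and> regs \<rho> rOne = 1 \<and> (regs \<rho> rX = 0 \<longleftrightarrow> source I = target I) \<and>
      cat_tape \<rho> = \<tau> \<and> out_tape \<rho> = []" for \<rho> :: state
    define Q' where "Q' \<rho> \<longleftrightarrow> regs \<rho> rOne = 1 \<and> cat_tape \<rho> = \<tau> \<and>
      out_tape \<rho> = [of_bool (source I = target I)]" for \<rho> :: state
    show ?thesis unfolding no_steps_prog_def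
    proof (intro runs_Seq)
      show "runs I W 0 (block ?cmp) 5 Q \<rho>"
      proof (rule runs_block[THEN runs_weaken, where P = Q])
        have d: "source I - target I < 2 ^ W" "target I - source I < 2 ^ W"
          "target I - source I + (source I - target I) < 2 ^ W" using st by linarith+
        show "block_ok I W 0 ?cmp \<rho>" using fit st d by simp
        show "Q (fold (effect I) ?cmp \<rho>)" using \<rho> by (auto simp: Q_def)
      qed auto
    next
      fix \<rho>' assume "fits W \<rho>'" "Q \<rho>'"
      then show "runs I W 0 (Branch rX (block [Emit 0]) (block [Emit rOne])) (Suc 1) Q' \<rho>'"
        by (intro runs_Branch runs_block[THEN runs_weaken, where P = Q']) (auto simp: Q_def Q'_def)
    next
      fix \<rho>' assume "fits W \<rho>'" "Q' \<rho>'"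
      then show "runs I W 0 (block [Emit rOne]) 1 ?Q \<rho>'"
        by (intro runs_block[THEN runs_weaken, where P = ?Q]) (auto simp: Q'_def)
    qed
  qed
  then have "\<exists>k\<le>(5 + (Suc 1 + 1)) + 5.
      catalytic_run estimator I (20 * W) 0 \<tau> k [of_bool (source I = target I), 1]"
    using W eps T by (intro estimator_start) auto
  moreover have "(5 + (Suc 1 + 1)) + 5 = (13::nat)" by simp
  ultimately show ?thesis by (simp only:)
qed

lemma estimator_steps:
  assumes "eps I < 1" "steps I > 0" "rotor_machine I W A bits" "2 ^ scale < (2 ^ W :: nat)"
  shows "\<exists>k\<le>main_time + 5. catalytic_run estimator I (20 * W) A \<tau> k
    [hit_count (2 ^ bits) 0 1 num_walks (counters bits \<tau>), num_walks]"
proof (rule estimator_start)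
  interpret rotor_machine I W A bits by fact
  show "1 < (2::nat) ^ W" using two_less by linarith
  show "steps I < 2 ^ W" by (rule steps_less)
  fix \<rho> assume "fits W \<rho>" "regs \<rho> 0 = 0" "regs \<rho> rOne = 1" "cat_tape \<rho> = \<tau>" "out_tape \<rho> = []"
  then show "runs I W A (if steps I = 0 then no_steps_prog else main_prog) main_time
    (\<lambda>\<sigma>'. cat_tape \<sigma>' = \<tau> \<and>
      out_tape \<sigma>' = [hit_count (2 ^ bits) 0 1 num_walks (counters bits \<tau>), num_walks]) \<rho>"
    using runs_main[OF assms(3,4,2), of \<rho> \<tau>] assms(2) by simp
qed (rule assms)

end

section \<open>Resource bounds\<close>

lemma lg_ge_1: "0 \<le> x \<Longrightarrow> 1 \<le> lg x"
  unfolding lg_def by (subst le_log_iff) auto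

lemma lg_mono: "0 \<le> x \<Longrightarrow> x \<le> y \<Longrightarrow> lg x \<le> lg y"
  unfolding lg_def by (subst log_le_cancel_iff) auto

lemma log_le_lg: "0 < x \<Longrightarrow> log 2 x \<le> lg x"
  unfolding lg_def by (subst log_le_cancel_iff) auto

text \<open>Both logarithms are at least 1, so their sum is at most twice their product. The product
  form allows the factors to be absorbed at different places of a bound.\<close>

lemma lg_mult_le:
  assumes "0 \<le> x" "0 \<le> y"
  shows "lg (x * y) \<le> 2 * lg x * lg y"
proof -
  have "2 + x * y \<le> (2 + x) * (2 + y)" using assms by (simp add: algebra_simps)
  then have "lg (x * y) \<le> log 2 ((2 + x) * (2 + y))"
    unfolding lg_def using assms by (subst log_le_cancel_iff) (auto intro: add_pos_nonneg)
  also have "\<dots> = lg x + lg y" unfolding lg_def using assms by (subst log_mult) auto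
  also have "\<dots> \<le> 2 * lg x * lg y"
  proof -
    have "lg x * 1 \<le> lg x * lg y" "1 * lg y \<le> lg x * lg y"
      using lg_ge_1[OF assms(1)] lg_ge_1[OF assms(2)] by (intro mult_mono; simp)+
    then show ?thesis by simp
  qed
  finally show ?thesis .
qed

lemma soft_O_ge:
  assumes "0 \<le> f" "x \<le> real C * ((1 + f) * lg f)"
  shows "x \<le> soft_O C 1 f"
  using assms by (simp add: soft_O_def mult.assoc)

lemma soft_O_ge_const:
  assumes "0 \<le> f" "x \<le> real C"
  shows "x \<le> soft_O C 1 f"
proof (rule soft_O_ge[OF assms(1)])
  have "1 * 1 \<le> (1 + f) * lg f" using assms lg_ge_1[of f] by (intro mult_mono) auto
  then have "real C * 1 \<le> real C * ((1 + f) * lg f)" by (intro mult_left_mono) auto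
  then show "x \<le> real C * ((1 + f) * lg f)" using assms by simp
qed

text \<open>As \<open>64 = 2 ^ 6\<close>, the least suitable length is at most
  \<open>7 + 2 * lg y\<close>, and \<open>lg y \<ge> 1\<close> absorbs the 7. The square is there
  for the tape size, a product of two factors linear in \<open>y\<close>.\<close>

lemma exists_word_size:
  assumes "1 \<le> (y :: real)"
  shows "\<exists>W. 64 * y\<^sup>2 < 2 ^ W \<and> real W \<le> 9 * lg y"
proof -
  define W where "W = nat \<lfloor>log 2 (64 * y\<^sup>2)\<rfloor> + 1"
  have y2: "1 \<le> y\<^sup>2" using assms by simp
  have "log 2 (64 * y\<^sup>2) = log 2 (2 ^ 6) + log 2 (y ^ 2)" using y2 by (subst log_mult) auto
  also have "\<dots> = 6 + 2 * log 2 y"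
    using assms by (simp only: log_nat_power) simp
  finally have L: "log 2 (64 * y\<^sup>2) = 6 + 2 * log 2 y" .
  have nn: "0 \<le> log 2 (64 * y\<^sup>2)" using L assms by simp
  then have W: "log 2 (64 * y\<^sup>2) < real W" "real W \<le> log 2 (64 * y\<^sup>2) + 1"
    unfolding W_def by linarith+
  have "64 * y\<^sup>2 = 2 powr log 2 (64 * y\<^sup>2)" using assms by (subst powr_log_cancel) auto
  also have "\<dots> < 2 powr real W" using W by simp
  finally have 1: "64 * y\<^sup>2 < 2 ^ W" by (simp add: powr_realpow)
  have "real W \<le> 7 + 2 * lg y" using W L log_le_lg[of y] assms by linarith
  also have "\<dots> \<le> 9 * lg y" using lg_ge_1[of y] assms by linarith
  finally show ?thesis using 1 by blast
qed

context rotor_walk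
begin

lemma n_pos: "0 < n"
  using source_in_V V_iff by (meson le_trans less_le_trans zero_less_one)

text \<open>By minimality, half of \<open>2 ^ scale\<close> is below \<open>1 / eps I\<close>; the
  case \<open>scale = 0\<close> rests on \<open>eps I < 1\<close>.\<close>

lemma two_power_scale_le:
  assumes "eps I < 1"
  shows "2 ^ scale \<le> 2 / eps I"
proof (cases scale)
  case 0
  then show ?thesis using assms eps_pos by (simp add: field_simps)
next
  case (Suc j)
  then have "2 ^ j * eps I < 1" using scale_iff[of j] by simp
  then show ?thesis using eps_pos by (simp add: Suc field_simps)
qed

text \<open>The largest counter address is \<open>steps I * n + n\<close>, belonging to the top
  layer and vertex \<open>n\<close>.\<close>

definition tape_size :: nat where
  "tape_size = Suc (steps I * n + n) * bits"

lemma rotor_machineI: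
  assumes "2 * 2 ^ bits \<le> (2 ^ W :: nat)" "card (arcs G) < 2 ^ W" "steps I < 2 ^ W"
    "tape_size < 2 ^ W"
  shows "rotor_machine I W tape_size bits"
  by unfold_locales (use assms in \<open>auto simp: tape_size_def bits_def\<close>)

text \<open>Restoring the tape is demanded for all valid inputs, also with fewer arcs than vertices.
  No resource bound is claimed here, so the word length may simply be a sum of all quantities, using
  \<open>W < 2 ^ W\<close>.\<close>

lemma estimator_halts: "\<exists>S A. \<forall>\<tau>. \<exists>time out. catalytic_run estimator I S A \<tau> time out"
proof -
  consider "eps I \<ge> 1" | "eps I < 1" "steps I = 0" | "eps I < 1" "steps I > 0" by linarith
  then show ?thesis
  proof cases
    case 1
    then show ?thesis using estimator_large_eps by blast
  next
    case 2
    have "n < 2 ^ Suc n" using less_exp[of "Suc n"] by linarith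
    moreover have "1 < (2::nat) ^ Suc n" using less_exp[of "Suc n"] by linarith
    ultimately show ?thesis using estimator_no_steps[OF 2, of "Suc n"] by blast
  next
    case 3
    define W where "W = Suc bits + (card (arcs G) + steps I + tape_size + scale)"
    have W: "W < 2 ^ W" by (rule less_exp)
    have "(2::nat) ^ Suc bits \<le> 2 ^ W" by (intro power_increasing) (auto simp: W_def)
    moreover have "(2::nat) ^ scale < 2 ^ W" by (intro power_strict_increasing) (auto simp: W_def)
    moreover have "card (arcs G) < 2 ^ W" "steps I < 2 ^ W" "tape_size < 2 ^ W"
      using W unfolding W_def by linarith+
    ultimately show ?thesis
      using estimator_steps[OF 3 rotor_machineI, of W] by (metis power_Suc)
  qed
qed

text \<open>Dividing the discrepancy \<open>3 m T\<close> by the number of walks leaves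
  \<open>1 / 2 ^ scale\<close>, which is at most \<open>eps I\<close>.\<close>

lemma estimate_error:
  assumes "num_walks > 0"
  shows "\<bar>real (hit_count (2 ^ bits) 0 1 num_walks (counters bits \<tau>)) / real num_walks -
    hit I (steps I) (source I)\<bar> \<le> eps I"
proof -
  let ?c = "real (hit_count (2 ^ bits) 0 1 num_walks (counters bits \<tau>))"
  let ?p = "hit I (steps I) (source I)"
  have pos: "real num_walks > 0" using assms by simp
  have "\<bar>?c - num_walks * ?p\<bar> \<le> 3 * real (card (arcs G)) * real (steps I)"
    by (rule hit_count_error) (auto intro: bits_le counters_less)
  also have "\<dots> \<le> 3 * real (card (arcs G)) * real (steps I) * (2 ^ scale * eps I)"
    using mult_left_mono[OF scale_le, of "3 * real (card (arcs G)) * real (steps I)"] by simp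
  also have "\<dots> = num_walks * eps I" by (simp add: num_walks_def)
  finally have "\<bar>?c - num_walks * ?p\<bar> \<le> num_walks * eps I" .
  moreover have "?c / num_walks - ?p = (?c - num_walks * ?p) / num_walks"
    using pos by (simp add: field_simps)
  ultimately show ?thesis using pos by (simp add: field_simps)
qed

section \<open>Bounds in terms of a single size parameter\<close>

context
  fixes y :: real
  assumes arcs: "n \<le> card (arcs G)" and eps: "eps I < 1"
    and y_def: "y = real (card (arcs G)) * max 1 (real (steps I)) / eps I"
begin

lemma arcs_pos: "1 \<le> real (card (arcs G))"
  using arcs n_pos by linarith

lemma arcs_div_eps_le: "real (card (arcs G)) \<le> real (card (arcs G)) / eps I"
  using eps eps_pos arcs_pos by (simp add: field_simps)

lemma y_ge: "real (card (arcs G)) / eps I * max 1 (real (steps I)) = y"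
  "real (card (arcs G)) / eps I \<le> y" "real (steps I) \<le> y" "1 / eps I \<le> y"
  "real n * real (steps I) \<le> y" "1 \<le> y" "real (card (arcs G)) \<le> y"
proof -
  let ?x = "real (card (arcs G)) / eps I" and ?M = "max 1 (real (steps I))"
  show y: "?x * ?M = y" by (simp add: y_def)
  have x: "1 \<le> ?x" using arcs_div_eps_le arcs_pos by linarith
  have "?x * 1 \<le> ?x * ?M" using x by (intro mult_left_mono) auto
  then show 1: "?x \<le> y" using y by simp
  then show "1 \<le> y" "real (card (arcs G)) \<le> y" using x arcs_div_eps_le by linarith+
  have "1 * ?M \<le> ?x * ?M" using x by (intro mult_right_mono) auto
  then show "real (steps I) \<le> y" using y by simp
  have "1 / eps I \<le> ?x" using arcs_pos eps_pos by (intro divide_right_mono) auto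
  then show "1 / eps I \<le> y" using 1 by linarith
  have "real n \<le> ?x" using arcs arcs_div_eps_le by linarith
  then have "real n * real (steps I) \<le> ?x * ?M" using x by (intro mult_mono) auto
  then show "real n * real (steps I) \<le> y" using y by simp
qed

lemma num_walks_le: "real num_walks \<le> 6 * (real (card (arcs G)) * real (steps I) / eps I)"
proof -
  have "real num_walks = 3 * (real (card (arcs G)) * real (steps I)) * 2 ^ scale"
    by (simp add: num_walks_def)
  also have "\<dots> \<le> 3 * (real (card (arcs G)) * real (steps I)) * (2 / eps I)"
    using two_power_scale_le[OF eps] by (intro mult_left_mono) auto
  finally show ?thesis by simp
qed

lemma num_walks_le_y: "real num_walks \<le> 6 * y"
proof -
  have "real (card (arcs G)) * real (steps I) / eps I \<le> y"
    unfolding y_def using eps_pos by (intro divide_right_mono mult_left_mono) auto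
  then show ?thesis using num_walks_le by linarith
qed

text \<open>The 14 is \<open>2 * 6 + 2\<close>, with the last summand absorbed by
  \<open>y \<ge> 1\<close>.\<close>

lemma two_power_bits_le_y: "2 ^ bits \<le> 14 * y"
proof -
  have "real (2 ^ bits) \<le> real (2 * num_walks + 2)"
    using two_power_bits_le by (simp only: of_nat_le_iff)
  then show ?thesis using num_walks_le_y y_ge(6) by simp
qed

lemma bits_le_lg: "real bits \<le> 5 * lg y"
proof -
  have "real bits = log 2 (2 ^ bits)" by simp
  also have "\<dots> \<le> log 2 (2 ^ 4 * y)"
    using two_power_bits_le_y y_ge(6) by (subst log_le_cancel_iff) auto
  also have "\<dots> = log 2 (2 ^ 4) + log 2 y" using y_ge(6) by (subst log_mult) auto
  also have "\<dots> = 4 + log 2 y" by (simp only: log_pow_cancel)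
  also have "\<dots> \<le> 5 * lg y" using log_le_lg[of y] lg_ge_1[of y] y_ge(6) by linarith
  finally show ?thesis .
qed

lemma tape_size_le:
  assumes "steps I > 0"
  shows "real tape_size \<le> 3 * (real n * real (steps I)) * real bits"
proof -
  have "n \<le> n * steps I" "1 \<le> n * steps I" using assms n_pos by (simp_all add: Suc_le_eq)
  then have "Suc (steps I * n + n) \<le> 3 * (n * steps I)" unfolding mult.commute[of "steps I" n] by linarith
  then have "tape_size \<le> 3 * (n * steps I) * bits" unfolding tape_size_def by (rule mult_right_mono) simp
  then have "real tape_size \<le> real (3 * (n * steps I) * bits)" by (simp only: of_nat_le_iff)
  then show ?thesis by simp
qed

text \<open>The tape size is the largest quantity to be addressed: at most \<open>3 * y\<close>
  times the counter length, crudely bounded by \<open>14 * y\<close>, hence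
  \<open>42 * y\<^sup>2\<close>. Everything else is linear in \<open>y\<close>.\<close>

lemma rotor_machine_word:
  assumes W: "64 * y\<^sup>2 < 2 ^ W" and T: "steps I > 0"
  shows "rotor_machine I W tape_size bits" "2 ^ scale < (2 ^ W :: nat)"
proof -
  have y: "1 \<le> y" by (rule y_ge)
  have yy: "y \<le> y\<^sup>2" using y by (simp add: power2_eq_square)
  have W': "64 * y < 2 ^ W" using W yy by linarith
  have lt: "k < 2 ^ W" if "real k \<le> 64 * y\<^sup>2" for k :: nat
  proof -
    have "real k < real (2 ^ W)" using that W unfolding of_nat_power of_nat_numeral by linarith
    then show ?thesis by (simp only: of_nat_less_iff)
  qed
  have "real (2 * 2 ^ bits) \<le> 64 * y\<^sup>2" using two_power_bits_le_y yy y by simp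
  then have 1: "2 * 2 ^ bits \<le> (2 ^ W :: nat)" using lt by (meson less_imp_le)
  have 2: "card (arcs G) < 2 ^ W" by (rule lt) (use y_ge(7) yy in linarith)
  have 3: "steps I < 2 ^ W" by (rule lt) (use y_ge(3) yy y in linarith)
  have "real bits \<le> 2 ^ bits" using of_nat_mono[OF less_imp_le[OF less_exp[of bits]], where 'a = real] by simp
  then have "real bits \<le> 14 * y" using two_power_bits_le_y by linarith
  then have "3 * (real n * real (steps I)) * real bits \<le> 3 * y * (14 * y)"
    using y_ge(5) y by (intro mult_mono) auto
  also have "\<dots> = 42 * y\<^sup>2" by (simp add: power2_eq_square)
  finally have "real tape_size \<le> 64 * y\<^sup>2"
    using tape_size_le[OF T] zero_le_power2[of y] by linarith
  then have 4: "tape_size < 2 ^ W" by (rule lt)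
  show "rotor_machine I W tape_size bits" using 1 2 3 4 by (rule rotor_machineI)
  have "real (2 ^ scale) \<le> 2 * y" using two_power_scale_le[OF eps] y_ge(4) by simp
  then show "2 ^ scale < (2 ^ W :: nat)" by (intro lt) (use yy y in linarith)
qed

text \<open>The counter length is logarithmic in \<open>m T / \<epsilon>\<close>, whereas the bound
  only names \<open>lg (m / \<epsilon>)\<close>. The logarithm of the product splits into a product
  of logarithms, and \<open>lg T\<close> is absorbed by the logarithmic factor of
  \<open>soft_O\<close>, since \<open>T\<close> is at most its argument.\<close>

lemma tape_size_soft_O:
  assumes T: "steps I > 0"
  shows "real tape_size \<le>
    soft_O 1500 1 (real n * real (steps I) * lg (real (card (arcs G)) / eps I))"
proof (rule soft_O_ge)
  let ?x = "real (card (arcs G)) / eps I" and ?T = "real (steps I)"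
  define f where "f = real n * ?T * lg ?x"
  have x: "0 \<le> ?x" using eps_pos by simp
  have T1: "1 \<le> ?T" using T by simp
  have nT: "?T \<le> real n * ?T" using n_pos T1 by simp
  have "real n * ?T * 1 \<le> f" unfolding f_def using lg_ge_1[OF x] by (intro mult_left_mono) auto
  then have Tf: "?T \<le> f" using nT by linarith
  then show f0: "0 \<le> real n * ?T * lg ?x" unfolding f_def by linarith
  have yT: "y = ?x * ?T" using y_ge(1) T1 by simp
  have "lg y \<le> 2 * lg ?x * lg ?T" unfolding yT using x by (intro lg_mult_le) auto
  also have "\<dots> \<le> 2 * lg ?x * lg f"
    using lg_mono[of ?T f] Tf lg_ge_1[OF x] by (intro mult_left_mono) auto
  finally have "real bits \<le> 10 * (lg ?x * lg f)" using bits_le_lg by linarith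
  then have "3 * (real n * ?T) * real bits \<le> 3 * (real n * ?T) * (10 * (lg ?x * lg f))"
    by (intro mult_left_mono) auto
  also have "\<dots> = 30 * (f * lg f)" by (simp add: f_def)
  also have "\<dots> \<le> 1500 * ((1 + f) * lg f)"
    using lg_ge_1[of f] f0 unfolding f_def[symmetric] by (intro mult_mono) auto
  finally show "real tape_size \<le> real 1500 * ((1 + real n * ?T * lg ?x) * lg (real n * ?T * lg ?x))"
    using tape_size_le[OF T] unfolding f_def[symmetric] of_nat_numeral by linarith
qed

text \<open>The number of walks is at most \<open>6 * y\<close>; each has \<open>T\<close> steps of
  cost linear in \<open>bits\<close>, and \<open>y * T\<close> is exactly the argument of
  \<open>soft_O\<close>. The counter length supplies its single logarithm.\<close>

lemma main_time_soft_O: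
  assumes T: "steps I > 0"
  shows "real (main_time + 5) \<le> soft_O 1500 1 (real (card (arcs G)) * (real (steps I))\<^sup>2 / eps I)"
proof (rule soft_O_ge)
  let ?T = "real (steps I)" and ?K = "real num_walks" and ?b = "real bits"
  define f where "f = real (card (arcs G)) * ?T\<^sup>2 / eps I"
  have T1: "1 \<le> ?T" using T by simp
  have yT: "y * ?T = f" unfolding y_def f_def using T1 by (simp add: power2_eq_square)
  have "y * 1 \<le> y * ?T" using y_ge(6) T1 by (intro mult_left_mono) auto
  then have yf: "y \<le> f" using yT by simp
  then show f0: "0 \<le> real (card (arcs G)) * ?T\<^sup>2 / eps I" using y_ge(6) unfolding f_def by linarith
  have l1: "1 \<le> lg f" using f0 unfolding f_def[symmetric] by (rule lg_ge_1)
  have lf: "lg y \<le> lg f" using y_ge(6) yf by (intro lg_mono) auto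
  have Kf: "?K \<le> 6 * f" using num_walks_le_y yf by linarith
  have "?K * ?T \<le> 6 * y * ?T" using num_walks_le_y by (intro mult_right_mono) auto
  then have KT: "?K * ?T \<le> 6 * f" using yT by simp
  have nf: "real n \<le> f" using arcs y_ge(7) yf by linarith
  have "real scale \<le> 2 ^ scale"
    using of_nat_mono[OF less_imp_le[OF less_exp[of scale]], where 'a = real] by simp
  moreover have "2 / eps I = 2 * (1 / eps I)" by simp
  ultimately have sf: "real scale \<le> 2 * f" using two_power_scale_le[OF eps] y_ge(4) yf by linarith
  have bl: "?b \<le> 5 * lg f" using bits_le_lg lf by linarith
  \<comment> \<open>Since \<open>lg f \<ge> 1\<close>, the 28 may be multiplied by it; this gives
    \<open>6 * (75 + 28) = 618\<close>.\<close>
  have "?K * ?T * (15 * ?b + 28) \<le> 6 * f * (15 * (5 * lg f) + 28 * lg f)"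
    using bl l1 f0 unfolding f_def[symmetric] by (intro mult_mono[OF KT]) auto
  then have big: "?K * ?T * (15 * ?b + 28) \<le> 618 * (f * lg f)" by (simp add: algebra_simps)
  have f_l: "f * 1 \<le> f * lg f" using l1 f0 unfolding f_def[symmetric] by (intro mult_left_mono)
  have "real (main_time + 5) =
      4 * real n + 4 * real scale + 4 * ?b + 2 * (?K * ?T * (15 * ?b + 28)) + 22 * ?K + 34"
    by (simp add: main_time_def algebra_simps)
  \<comment> \<open>The coefficients of \<open>f\<close> and \<open>f * lg f\<close> add up to 1380,
    and 1236 of it comes from the two passes of walks. This is the origin of the constant
    1500.\<close>
  also have "\<dots> \<le> 4 * f + 8 * f + 20 * lg f + 1236 * (f * lg f) + 132 * f + 34 * lg f"
    using nf sf bl big Kf l1 by linarith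
  also have "\<dots> \<le> 1500 * (lg f + f * lg f)"
  proof -
    have "0 \<le> f" using yf y_ge(6) by linarith
    then have "f \<le> f * lg f" "0 \<le> f * lg f" using f_l l1 by simp_all
    then show ?thesis using l1 unfolding distrib_left by linarith
  qed
  also have "\<dots> = 1500 * ((1 + f) * lg f)" by (simp add: algebra_simps)
  finally show "real (main_time + 5) \<le> real 1500 *
      ((1 + real (card (arcs G)) * ?T\<^sup>2 / eps I) * lg (real (card (arcs G)) * ?T\<^sup>2 / eps I))"
    unfolding f_def[symmetric] by simp
qed

end

end

theorem theorem1p6:
  shows "\<exists>(P :: prog) (C :: nat) (k :: nat).
    catalytic_algorithm P \<and>
    (\<forall>I. valid_input I \<and> card (arcs (graph I)) \<ge> card (verts (graph I)) \<longrightarrow>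
      (let n = real (card (verts (graph I)));
           m = real (card (arcs (graph I)));
           T = real (steps I);
           \<epsilon> = eps I
       in \<exists>S A :: nat.
            real S \<le> real C * lg (m * max 1 T / \<epsilon>) \<and>
            real A \<le> soft_O C k (n * T * lg (m / \<epsilon>)) \<and>
            (\<forall>\<tau>. \<exists>time out \<rho>.
               catalytic_run P I S A \<tau> time out \<and>
               encodes out \<rho> \<and>
               \<bar>\<rho> - pmf (walk_end (graph I) (source I) (steps I)) (target I)\<bar> \<le> \<epsilon> \<and>
               real time \<le> soft_O C k (m * T\<^sup>2 / \<epsilon>))))"
proof (rule exI[of _ estimator], rule exI[of _ 1500], rule exI[of _ 1], intro conjI allI impI)
  show "catalytic_algorithm estimator"
    unfolding catalytic_algorithm_def
    by (intro allI impI rotor_walk.estimator_halts rotor_walk.intro)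
next
  fix I assume asm: "valid_input I \<and> card (arcs (graph I)) \<ge> card (verts (graph I))"
  interpret rotor_walk I using asm by (simp add: rotor_walk_def)
  define m T where "m = real (card (arcs G))" and "T = real (steps I)"
  define y where "y = m * max 1 T / eps I"
  have arcs: "n \<le> card (arcs G)" using asm by simp
  have e: "eps I > 0" by (rule eps_pos)
  have nonneg: "0 \<le> m" "0 \<le> T" "0 \<le> y" "0 \<le> m / eps I" "0 \<le> m * T\<^sup>2 / eps I"
    using e by (simp_all add: m_def T_def y_def)
  have f0: "0 \<le> real n * T * lg (m / eps I)"
    using lg_ge_1[of "m / eps I"] nonneg by simp
  have p: "pmf (walk_end G (source I) (steps I)) (target I) = hit I (steps I) (source I)"
    by (simp add: hit_def)
  have "\<exists>S A :: nat. real S \<le> real 1500 * lg y \<and>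
      real A \<le> soft_O 1500 1 (real n * T * lg (m / eps I)) \<and>
      (\<forall>\<tau>. \<exists>time out \<rho>. catalytic_run estimator I S A \<tau> time out \<and> encodes out \<rho> \<and>
        \<bar>\<rho> - hit I (steps I) (source I)\<bar> \<le> eps I \<and>
        real time \<le> soft_O 1500 1 (m * T\<^sup>2 / eps I))"
  proof (cases "eps I \<ge> 1")
    case True
    have "\<exists>time out \<rho>. catalytic_run estimator I (20 * 1) 0 \<tau> time out \<and> encodes out \<rho> \<and>
        \<bar>\<rho> - hit I (steps I) (source I)\<bar> \<le> eps I \<and> real time \<le> soft_O 1500 1 (m * T\<^sup>2 / eps I)" for \<tau>
    proof -
      obtain k where k: "k \<le> 5" "catalytic_run estimator I (20 * 1) 0 \<tau> k [0, 1]"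
        using estimator_large_eps[OF True] by blast
      have "encodes [0, 1] 0" by (simp add: encodes_def)
      moreover have "\<bar>0 - hit I (steps I) (source I)\<bar> \<le> eps I"
        using hit_bounds[of I "steps I" "source I"] True by simp
      moreover have "real k \<le> soft_O 1500 1 (m * T\<^sup>2 / eps I)"
        by (rule soft_O_ge_const[OF nonneg(5)]) (use k in simp)
      ultimately show ?thesis using k by blast
    qed
    moreover have "real (20 * 1) \<le> real 1500 * lg y" using lg_ge_1[OF nonneg(3)] by simp
    moreover have "real 0 \<le> soft_O 1500 1 (real n * T * lg (m / eps I))"
      by (rule soft_O_ge_const[OF f0]) simp
    ultimately show ?thesis by blast
  next
    case False
    then have eps: "eps I < 1" by simp
    note ctx = arcs eps y_def[unfolded m_def T_def]
    have y1: "1 \<le> y" by (rule y_ge(6)[OF ctx])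
    obtain W where W: "64 * y\<^sup>2 < 2 ^ W" "real W \<le> 9 * lg y"
      using exists_word_size[OF y1] by blast
    have S: "real (20 * W) \<le> real 1500 * lg y" using W lg_ge_1[OF nonneg(3)] by simp
    show ?thesis
    proof (cases "steps I = 0")
      case T0: True
      have "y \<le> y\<^sup>2" using y1 by (simp add: power2_eq_square)
      then have "real n < real (2 ^ W)" "real 1 < real (2 ^ W)"
        using W y1 y_ge(7)[OF ctx] arcs unfolding of_nat_power of_nat_numeral by linarith+
      then have nW: "n < 2 ^ W" "1 < (2::nat) ^ W" by (simp_all only: of_nat_less_iff)
      have "\<exists>time out \<rho>. catalytic_run estimator I (20 * W) 0 \<tau> time out \<and> encodes out \<rho> \<and>
        \<bar>\<rho> - hit I (steps I) (source I)\<bar> \<le> eps I \<and> real time \<le> soft_O 1500 1 (m * T\<^sup>2 / eps I)" for \<tau>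
      proof -
        obtain k where k: "k \<le> 13"
          "catalytic_run estimator I (20 * W) 0 \<tau> k [of_bool (source I = target I), 1]"
          using estimator_no_steps[OF eps T0 nW(2,1)] by blast
        have "encodes [of_bool (source I = target I), 1] (of_bool (source I = target I))"
          by (simp add: encodes_def)
        moreover have "\<bar>of_bool (source I = target I) - hit I (steps I) (source I)\<bar> \<le> eps I"
          using e by (simp add: hit_def T0 pmf_return indicator_def)
        moreover have "real k \<le> soft_O 1500 1 (m * T\<^sup>2 / eps I)"
          by (rule soft_O_ge_const[OF nonneg(5)]) (use k in simp)
        ultimately show ?thesis using k by blast
      qed
      moreover have "real 0 \<le> soft_O 1500 1 (real n * T * lg (m / eps I))"
        by (rule soft_O_ge_const[OF f0]) simp
      ultimately show ?thesis using S by blast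
    next
      case False
      then have T0: "steps I > 0" by simp
      have K: "num_walks > 0" using arcs_pos[OF arcs eps refl] T0 by (simp add: num_walks_def)
      have "\<exists>time out \<rho>. catalytic_run estimator I (20 * W) tape_size \<tau> time out \<and> encodes out \<rho> \<and>
        \<bar>\<rho> - hit I (steps I) (source I)\<bar> \<le> eps I \<and> real time \<le> soft_O 1500 1 (m * T\<^sup>2 / eps I)" for \<tau>
      proof -
        let ?c = "hit_count (2 ^ bits) 0 1 num_walks (counters bits \<tau>)"
        obtain k where k: "k \<le> main_time + 5"
          "catalytic_run estimator I (20 * W) tape_size \<tau> k [?c, num_walks]"
          using estimator_steps[OF eps T0 rotor_machine_word[OF ctx W(1) T0]] by blast
        have "encodes [?c, num_walks] (real ?c / real num_walks)" using K by (simp add: encodes_def)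
        moreover have "real k \<le> soft_O 1500 1 (m * T\<^sup>2 / eps I)"
          using main_time_soft_O[OF ctx T0] k(1) unfolding m_def T_def by linarith
        ultimately show ?thesis using k(2) estimate_error[OF K] by blast
      qed
      moreover have "real tape_size \<le> soft_O 1500 1 (real n * T * lg (m / eps I))"
        using tape_size_soft_O[OF ctx T0] by (simp only: m_def T_def)
      ultimately show ?thesis using S by blast
    qed
  qed
  then show "let n = real n; m = real (card (arcs G)); T = real (steps I); \<epsilon> = eps I
       in \<exists>S A :: nat.
            real S \<le> real 1500 * lg (m * max 1 T / \<epsilon>) \<and>
            real A \<le> soft_O 1500 1 (n * T * lg (m / \<epsilon>)) \<and>
            (\<forall>\<tau>. \<exists>time out \<rho>.
               catalytic_run estimator I S A \<tau> time out \<and>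
               encodes out \<rho> \<and>
               \<bar>\<rho> - pmf (walk_end G (source I) (steps I)) (target I)\<bar> \<le> \<epsilon> \<and>
               real time \<le> soft_O 1500 1 (m * T\<^sup>2 / \<epsilon>))"
    unfolding Let_def p m_def T_def y_def .
qed

end
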